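(* The group $\mathrm{PL}(I^2,\partial I^2)$ is locally indicable, and therefore left-orderable.
   Context: $I^2=[0,1]^2$. $\mathrm{PL}(I^2,\partial I^2)$ is the group, under composition, of homeomorphisms $I^2\to I^2$ that are pointwise fixed on the boundary $\partial I^2$ and are linear on each simplex of some finite triangulation (subdivision) of $I^2$. A group is locally indicable if every nontrivial finitely generated subgroup admits a surjection onto $\mathbb Z$; it is left-orderable if it admits a strict total order invariant under left multiplication. *)

theory Defs
  imports "HOL-Analysis.Analysis" "HOL-Algebra.Elementary_Groups"
begin

definition square :: "(real^2) set" where
  "square = {x. \<forall>i. 0 \<le> x $ i \<and> x $ i \<le> 1}"

definition square_boundary :: "(real^2) set" where
  "square_boundary = frontier square"

definition piecewise_linear_square :: "(real^2 \<Rightarrow> real^2) \<Rightarrow> bool" where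
  "piecewise_linear_square f \<longleftrightarrow>
     (\<exists>\<T>. triangulation \<T> \<and> \<Union>\<T> = square \<and>
        (\<forall>T\<in>\<T>. \<exists>A b. linear A \<and> (\<forall>x\<in>T. f x = A x + b)))"

text \<open>Elements of PL(I^2, boundary I^2). Maps are extended by the identity outside
  the square, so that the group operation is plain function composition.\<close>
definition PL_square_set :: "(real^2 \<Rightarrow> real^2) set" where
  "PL_square_set = {f. (\<exists>g. homeomorphism square square f g)
                      \<and> (\<forall>x\<in>square_boundary. f x = x)
                      \<and> piecewise_linear_square f
                      \<and> (\<forall>x. x \<notin> square \<longrightarrow> f x = x)}"

definition PL_square :: "(real^2 \<Rightarrow> real^2) monoid" where
  "PL_square = \<lparr>carrier = PL_square_set, monoid.mult = (\<circ>), one = id\<rparr>"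

definition locally_indicable :: "('a, 'b) monoid_scheme \<Rightarrow> bool" where
  "locally_indicable G \<longleftrightarrow>
     (\<forall>H. subgroup H G \<longrightarrow> H \<noteq> {\<one>\<^bsub>G\<^esub>} \<longrightarrow>
        (\<exists>S. finite S \<and> S \<subseteq> carrier G \<and> generate G S = H) \<longrightarrow>
        (\<exists>\<phi>. \<phi> \<in> hom (G\<lparr>carrier := H\<rparr>) integer_group \<and> \<phi> ` H = carrier integer_group))"

definition left_orderable :: "('a, 'b) monoid_scheme \<Rightarrow> bool" where
  "left_orderable G \<longleftrightarrow>
     (\<exists>r. r \<subseteq> carrier G \<times> carrier G \<and> strict_linear_order_on (carrier G) r \<and>
        (\<forall>g\<in>carrier G. \<forall>a\<in>carrier G. \<forall>b\<in>carrier G.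
           (a, b) \<in> r \<longrightarrow> (g \<otimes>\<^bsub>G\<^esub> a, g \<otimes>\<^bsub>G\<^esub> b) \<in> r))"

end

theory Submission
  imports Defs
begin

text \<open>
  For reals t, a, b, the triple (t, a, b) stands for the germ, as s tends to 0 from the right, of
  the ray s \<mapsto> (t + s, a + b s); such germs are ordered lexicographically.  Sweep the square
  from left to right and, on each vertical line, upwards.  A nontrivial PL homeomorphism f has a
  first ray at which it moves something: everything before the ray is fixed, and just above the
  ray f is an affine map fixing the ray pointwise, i.e. a map z \<mapsto> z + h(z) w, where
  h(z) is the height of z above the ray and w \<noteq> 0.  The maps fixing everything before a
  given ray form a group, on which f \<mapsto> w is a homomorphism to the affine group of
  matrices (1, w1; 0, \<lambda>) with \<lambda> > 0.  A finitely generated group is therefore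
  detected by the smallest first ray of its generators: either ln \<lambda> or a coordinate of w
  is a nonzero homomorphism to the reals, whose image is finitely generated and hence maps
  onto the integers.  Comparing \<lambda> with 1, and then w1 with 0, at the first ray of f gives
  a left order directly, without the Burns-Hale theorem.
\<close>

section \<open>Homomorphisms onto the integers\<close>

text \<open>The reals form a vector space over the rationals. A nonzero c is independent by itself,
  so some rational-linear functional takes the value 1 at c.\<close>

lemma additive_real_to_rat_nonzero:
  fixes c :: real
  assumes "c \<noteq> 0"
  shows "\<exists>f :: real \<Rightarrow> rat. (\<forall>x y. f (x + y) = f x + f y) \<and> f c \<noteq> 0"
proof -
  interpret vector_space_pair "\<lambda>(q::rat) (x::real). of_rat q * x" "\<lambda>(q::rat) (x::rat). q * x"
    by unfold_locales (auto simp: algebra_simps of_rat_add of_rat_mult)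
  have "vs1.independent {c}"
    using assms by simp
  then obtain f where f: "Vector_Spaces.linear (\<lambda>q x. of_rat q * x) (\<lambda>q x. q * x) f" "f c = (1::rat)"
    using linear_independent_extend[of "{c}" "\<lambda>_. 1"] by auto
  then interpret f: Vector_Spaces.linear "\<lambda>(q::rat) (x::real). of_rat q * x" "\<lambda>(q::rat) (x::rat). q * x" f
    by simp
  show ?thesis
    using f(2) f.add by (intro exI[of _ f]) auto
qed

lemma rat_common_denominator:
  fixes g :: "'a \<Rightarrow> rat"
  assumes "finite S"
  shows "\<exists>D::int. D > 0 \<and> (\<forall>s\<in>S. of_int D * g s \<in> \<int>)"
  using assms
proof induction
  case empty
  show ?case by (intro exI[of _ 1]) auto
next
  case (insert x S)
  then obtain D :: int where D: "D > 0" "\<forall>s\<in>S. of_int D * g s \<in> \<int>" by blast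
  obtain p q where pq: "quotient_of (g x) = (p, q)" by fastforce
  have q: "q > 0" "g x = of_int p / of_int q"
    using pq quotient_of_denom_pos quotient_of_div by blast+
  have "of_int (D * q) * g x = of_int (D * p)"
    using q by simp
  then have "of_int (D * q) * g x \<in> \<int>"
    by (metis Ints_of_int)
  moreover have "of_int (D * q) * g s \<in> \<int>" if "s \<in> S" for s
  proof -
    have "of_int (D * q) * g s = of_int q * (of_int D * g s)" by simp
    then show ?thesis using D(2) that by (metis Ints_mult Ints_of_int)
  qed
  ultimately show ?case using D(1) q(1) by (intro exI[of _ "D * q"]) auto
qed

text \<open>Take for d the least positive element. Division by d leaves a remainder that lies in I
  and is smaller than d, so it vanishes.\<close>

lemma int_subgroup_multiples:
  fixes I :: "int set"
  assumes zero: "0 \<in> I" and add: "\<And>x y. x \<in> I \<Longrightarrow> y \<in> I \<Longrightarrow> x + y \<in> I"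
    and neg: "\<And>x. x \<in> I \<Longrightarrow> - x \<in> I" and nz: "m \<in> I" "m \<noteq> 0"
  shows "\<exists>d>0. I = range ((*) d)"
proof -
  define d where "d = (LEAST n::nat. n > 0 \<and> int n \<in> I)"
  have "\<exists>n::nat. n > 0 \<and> int n \<in> I"
    using nz neg[OF nz(1)] by (cases "m > 0") (auto intro: exI[of _ "nat m"] exI[of _ "nat (- m)"])
  then have d: "d > 0" "int d \<in> I"
    using LeastI_ex[of "\<lambda>n. n > 0 \<and> int n \<in> I"] unfolding d_def by auto
  have min: "d \<le> n" if "n > 0" "int n \<in> I" for n
    unfolding d_def using that by (auto intro: Least_le)
  have natmul: "int d * int n \<in> I" for n
    by (induction n) (use zero add d in \<open>auto simp: algebra_simps\<close>)
  have mul: "int d * k \<in> I" for k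
    using natmul[of "nat k"] neg[OF natmul[of "nat (- k)"]] by (cases "k \<ge> 0") auto
  have "x \<in> range ((*) (int d))" if "x \<in> I" for x
  proof -
    have "x mod int d = x + int d * (- (x div int d))"
      by (simp add: minus_mult_div_eq_mod)
    then have *: "x mod int d \<in> I" using add[OF that mul] by metis
    have "x mod int d = 0"
    proof (rule ccontr)
      assume "x mod int d \<noteq> 0"
      moreover have "x mod int d \<ge> 0" using d by simp
      ultimately have "nat (x mod int d) > 0" "int (nat (x mod int d)) \<in> I"
        using * by auto
      then show False using min[of "nat (x mod int d)"] d pos_mod_bound[of "int d" x] by linarith
    qed
    then show ?thesis by (auto elim!: dvdE simp: dvd_eq_mod_eq_0[symmetric])
  qed
  then show ?thesis using d(1) mul by (intro exI[of _ "int d"]) auto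
qed

text \<open>A rational-linear functional that does not vanish at \<open>\<psi> h\<close> makes the
  values rational. Finite generation supplies a common denominator D for the generators, hence for
  all of H, and dividing by the positive generator d of the resulting group of integers makes the
  map onto.\<close>

lemma (in group) finitely_generated_hom_onto_int:
  fixes \<psi> :: "'a \<Rightarrow> real"
  assumes H: "subgroup H G" and S: "finite S" "generate G S = H"
    and add: "\<And>x y. x \<in> H \<Longrightarrow> y \<in> H \<Longrightarrow> \<psi> (x \<otimes> y) = \<psi> x + \<psi> y"
    and nz: "h \<in> H" "\<psi> h \<noteq> 0"
  shows "\<exists>\<phi>. \<phi> \<in> hom (G\<lparr>carrier := H\<rparr>) integer_group \<and> \<phi> ` H = carrier integer_group"
proof -
  interpret H: subgroup H G by fact
  obtain f :: "real \<Rightarrow> rat" where f: "\<And>x y. f (x + y) = f x + f y" "f (\<psi> h) \<noteq> 0"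
    using additive_real_to_rat_nonzero[OF nz(2)] by auto
  obtain D :: int where D: "D > 0" "\<forall>s\<in>S. of_int D * f (\<psi> s) \<in> \<int>"
    using rat_common_denominator[OF S(1), of "\<lambda>s. f (\<psi> s)"] by auto
  define g where "g x = of_int D * f (\<psi> x)" for x
  have g_add: "g (x \<otimes> y) = g x + g y" if "x \<in> H" "y \<in> H" for x y
    using that by (simp add: g_def add f algebra_simps)
  have g_one: "g \<one> = 0"
    using g_add[of \<one> \<one>] by simp
  have g_inv: "g (inv x) = - g x" if "x \<in> H" for x
    using g_add[of x "inv x"] g_one that by (simp add: r_inv add_eq_0_iff)
  have g_int: "g x \<in> \<int>" if "x \<in> generate G S" for x
    using that
  proof induction
    case (incl h) then show ?case using D by (simp add: g_def)
  next
    case (inv h)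
    then have "h \<in> H" using generate.incl[of h S G] S(2) by simp
    then have "g (inv h) = - (of_int D * f (\<psi> h))"
      using g_inv by (simp add: g_def)
    then show ?case using D inv by simp
  next
    case (eng h1 h2)
    then show ?case using g_add[of h1 h2] S(2) by simp
  qed (simp add: g_one)
  \<comment> \<open>On H the values of \<open>g\<close> are integers already; the floor only turns
    them into elements of type \<open>int\<close>.\<close>
  define k where "k x = \<lfloor>g x\<rfloor>" for x
  have k: "of_int (k x) = g x" if "x \<in> H" for x
    using g_int S that by (auto simp: k_def)
  have k_add: "k (x \<otimes> y) = k x + k y" if "x \<in> H" "y \<in> H" for x y
  proof -
    have "(of_int (k (x \<otimes> y)) :: rat) = of_int (k x + k y)"
      using that by (simp add: k g_add)
    then show ?thesis by linarith
  qed
  have k_inv: "k (inv x) = - k x" if "x \<in> H" for x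
  proof -
    have "(of_int (k (inv x)) :: rat) = of_int (- k x)"
      using that by (simp add: k g_inv)
    then show ?thesis by linarith
  qed
  have "\<exists>d>0. k ` H = range ((*) d)"
  proof (rule int_subgroup_multiples)
    show "0 \<in> k ` H" using H.one_closed by (intro image_eqI[of _ _ \<one>]) (auto simp: k_def g_one)
    show "x + y \<in> k ` H" if "x \<in> k ` H" "y \<in> k ` H" for x y
      using that k_add H.m_closed by (metis (no_types, opaque_lifting) imageE image_eqI)
    show "- x \<in> k ` H" if "x \<in> k ` H" for x
      using that k_inv H.m_inv_closed by (metis (no_types, opaque_lifting) imageE image_eqI)
    show "k h \<in> k ` H" using nz by auto
    show "k h \<noteq> 0"
      using k[OF nz(1)] f(2) D(1) by (auto simp: g_def)
  qed
  then obtain d where d: "d > 0" "k ` H = range ((*) d)" by auto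
  have div: "d dvd k x" if "x \<in> H" for x
  proof -
    have "k x \<in> range ((*) d)" using d(2) imageI[OF that, of k] by simp
    then show ?thesis by auto
  qed
  define \<phi> where "\<phi> x = k x div d" for x
  have "\<phi> \<in> hom (G\<lparr>carrier := H\<rparr>) integer_group"
    using div by (auto simp: hom_def \<phi>_def k_add)
  moreover have "\<phi> ` H = UNIV"
  proof -
    have "n \<in> \<phi> ` H" for n
    proof -
      have "d * n \<in> k ` H" using d by simp
      then obtain x where "x \<in> H" "k x = d * n" by auto
      then show ?thesis using d(1) by (intro image_eqI[of _ _ x]) (auto simp: \<phi>_def)
    qed
    then show ?thesis by blast
  qed
  ultimately show ?thesis by auto
qed

section \<open>Piecewise linear maps of the square\<close>

text \<open>For convex C containing 0, the nonnegative multiples of differences of points of C form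
  a subspace, so each vector of the span is some c (p - q). If A kills it and c is nonzero, then A p
  = A q and p = q.\<close>

lemma inj_on_convex_imp_inj_on_span:
  fixes A :: "'a::real_vector \<Rightarrow> 'b::real_vector"
  assumes "linear A" "convex C" "0 \<in> C" "inj_on A C"
  shows "inj_on A (span C)"
proof -
  interpret A: linear A by fact
  define W where "W = {c *\<^sub>R (x - y) | c x y. c \<ge> 0 \<and> x \<in> C \<and> y \<in> C}"
  have WI: "c *\<^sub>R (x - y) \<in> W" if "c \<ge> 0" "x \<in> C" "y \<in> C" for c x y
    unfolding W_def using that by blast
  have zero: "0 \<in> W" using WI[of 0 0 0] \<open>0 \<in> C\<close> by simp
  have "subspace W"
  proof (rule subspaceI)
    show "0 \<in> W" by (rule zero)
  next
    fix v w assume "v \<in> W" "w \<in> W"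
    then obtain c x y d p q where *: "c \<ge> 0" "d \<ge> 0" "x \<in> C" "y \<in> C" "p \<in> C" "q \<in> C"
      and v: "v = c *\<^sub>R (x - y)" and w: "w = d *\<^sub>R (p - q)" by (auto simp: W_def)
    show "v + w \<in> W"
    proof (cases "c + d = 0")
      case True
      then have "c = 0" "d = 0" using * by auto
      then show ?thesis using zero v w by simp
    next
      case False
      then have cd: "c + d > 0" using * by auto
      \<comment> \<open>Weights proportional to c and d merge the two differences into a single one
        with factor c + d.\<close>
      define x' y' where "x' = (c / (c + d)) *\<^sub>R x + (d / (c + d)) *\<^sub>R p"
        and "y' = (c / (c + d)) *\<^sub>R y + (d / (c + d)) *\<^sub>R q"
      have 1: "c / (c + d) + d / (c + d) = 1" using cd by (simp add: add_divide_distrib[symmetric])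
      have "x' \<in> C" "y' \<in> C"
        unfolding x'_def y'_def using * cd 1 by (auto intro!: convexD[OF \<open>convex C\<close>])
      moreover have "v + w = (c + d) *\<^sub>R (x' - y')"
      proof -
        have "(c + d) *\<^sub>R x' = c *\<^sub>R x + d *\<^sub>R p" "(c + d) *\<^sub>R y' = c *\<^sub>R y + d *\<^sub>R q"
          using cd by (simp_all add: x'_def y'_def scaleR_add_right)
        then show ?thesis by (simp add: v w scaleR_diff_right)
      qed
      ultimately show ?thesis using cd WI by simp
    qed
  next
    fix r v assume "v \<in> W"
    then obtain c x y where *: "c \<ge> 0" "x \<in> C" "y \<in> C" "v = c *\<^sub>R (x - y)" by (auto simp: W_def)
    show "r *\<^sub>R v \<in> W"
    proof (cases "r \<ge> 0")
      case True
      then have "r *\<^sub>R v = (r * c) *\<^sub>R (x - y)" "r * c \<ge> 0" using * by simp_all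
      then show ?thesis using * WI by simp
    next
      case False
      then have "- r * c \<ge> 0" using * mult_nonneg_nonneg[of "- r" c] by simp
      moreover have "r *\<^sub>R v = (- r * c) *\<^sub>R (y - x)" unfolding * by (simp add: algebra_simps)
      ultimately show ?thesis using *(2,3) WI by metis
    qed
  qed
  moreover have "C \<subseteq> W"
  proof
    show "x \<in> W" if "x \<in> C" for x using WI[of 1 x 0] that \<open>0 \<in> C\<close> by simp
  qed
  ultimately have "span C \<subseteq> W" by (simp add: span_minimal)
  moreover have "x = 0" if "x \<in> W" "A x = 0" for x
  proof -
    obtain c p q where *: "x = c *\<^sub>R (p - q)" "p \<in> C" "q \<in> C" using \<open>x \<in> W\<close> by (auto simp: W_def)
    show ?thesis
    proof (cases "c = 0")
      case False
      then have "A p = A q" using * that(2) by (simp add: A.scaleR A.diff)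
      then show ?thesis using * \<open>inj_on A C\<close> by (auto dest: inj_onD)
    qed (simp add: *)
  qed
  ultimately show ?thesis
    by (subst linear_injective_on_subspace_0[OF \<open>linear A\<close> subspace_span]) auto
qed

section \<open>Affine maps on convex sets, polyhedra and faces\<close>

definition affine_linear_on :: "'a::real_vector set \<Rightarrow> ('a \<Rightarrow> 'b::real_vector) \<Rightarrow> bool" where
  "affine_linear_on T f \<longleftrightarrow> (\<exists>A b. linear A \<and> (\<forall>x\<in>T. f x = A x + b))"

lemma affine_linear_on_subset: "affine_linear_on T f \<Longrightarrow> S \<subseteq> T \<Longrightarrow> affine_linear_on S f"
  unfolding affine_linear_on_def by blast

lemma affine_linear_on_compose:
  assumes "affine_linear_on T g" "affine_linear_on (g ` T) f"
  shows "affine_linear_on T (f \<circ> g)"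
proof -
  obtain A b where g: "linear A" "\<forall>x\<in>T. g x = A x + b"
    using assms by (auto simp: affine_linear_on_def)
  obtain B c where f: "linear B" "\<forall>x\<in>g`T. f x = B x + c"
    using assms by (auto simp: affine_linear_on_def)
  show ?thesis unfolding affine_linear_on_def
    using f g by (intro exI[of _ "B \<circ> A"] exI[of _ "B b + c"])
      (auto simp: linear_compose linear_add)
qed

lemma affine_combination:
  fixes A :: "'a::real_vector \<Rightarrow> 'b::real_vector"
  assumes "linear A" "u + v = 1"
  shows "A (u *\<^sub>R x + v *\<^sub>R y) + c = u *\<^sub>R (A x + c) + v *\<^sub>R (A y + c)"
proof -
  have "c = u *\<^sub>R c + v *\<^sub>R c" using assms(2) by (metis scaleR_left_distrib scaleR_one)
  then show ?thesis using assms(1) by (simp add: linear_add linear_scale scaleR_add_right)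
qed

text \<open>T may have empty interior, so A itself need not be invertible. After a point of T is
  moved to 0, A is injective on the span of T, and a linear left inverse on that span represents
  h.\<close>

lemma affine_linear_on_inverse:
  fixes f :: "'a::euclidean_space \<Rightarrow> 'b::euclidean_space"
  assumes f: "affine_linear_on T f" and "convex T" and inv: "\<And>x. x \<in> T \<Longrightarrow> h (f x) = x"
  shows "affine_linear_on (f ` T) h"
proof (cases "T = {}")
  case True
  then show ?thesis by (auto simp: affine_linear_on_def intro: exI[of _ "\<lambda>_. 0"] linear_zero)
next
  case False
  then obtain x0 where x0: "x0 \<in> T" by blast
  obtain A b where A: "linear A" and fA: "\<And>x. x \<in> T \<Longrightarrow> f x = A x + b"
    using f by (auto simp: affine_linear_on_def)
  define C where "C = (\<lambda>x. x - x0) ` T"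
  have "convex C" unfolding C_def using \<open>convex T\<close> by (simp add: convex_translation_subtract)
  moreover have "0 \<in> C" using x0 by (auto simp: C_def)
  moreover have "inj_on A C"
  proof (rule inj_onI)
    fix x y assume "x \<in> C" "y \<in> C" and eq: "A x = A y"
    then obtain p q where pq: "p \<in> T" "q \<in> T" "x = p - x0" "y = q - x0" by (auto simp: C_def)
    then have "f p = f q" using eq A fA by (simp add: linear_diff)
    then show "x = y" using inv pq by metis
  qed
  ultimately have "inj_on A (span C)"
    using inj_on_convex_imp_inj_on_span A by blast
  then obtain B where B: "linear B" "\<And>v. v \<in> span C \<Longrightarrow> B (A v) = v"
    using linear_exists_left_inverse_on[OF A subspace_span] by blast
  have "h y = B y + (x0 - B (A x0 + b))" if y: "y \<in> f ` T" for y
  proof -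
    obtain x where x: "x \<in> T" "y = f x" using y by auto
    have "B (A (x - x0)) = x - x0" using x by (intro B span_base) (auto simp: C_def)
    then show ?thesis using x inv fA A B(1) by (simp add: linear_diff linear_add algebra_simps)
  qed
  then show ?thesis using B(1) unfolding affine_linear_on_def by blast
qed

lemma polyhedron_affine_vimage:
  fixes A :: "'a::euclidean_space \<Rightarrow> 'b::euclidean_space"
  assumes "linear A" "polyhedron T"
  shows "polyhedron {x. A x + b \<in> T}"
proof -
  obtain F where F: "finite F" "T = \<Inter>F" "\<forall>h\<in>F. \<exists>a c. a \<noteq> 0 \<and> h = {x. a \<bullet> x \<le> c}"
    using assms(2) unfolding polyhedron_def by blast
  have "{x. A x + b \<in> T} = \<Inter>((\<lambda>h. {x. A x + b \<in> h}) ` F)" using F(2) by auto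
  moreover have "polyhedron {x. A x + b \<in> h}" if h: "h \<in> F" for h
  proof -
    obtain a c where "h = {x. a \<bullet> x \<le> c}" using F(3) h by blast
    \<comment> \<open>The adjoint moves A onto the normal vector. The new normal may be 0; the set
      is then empty or everything, which is still a polyhedron.\<close>
    moreover have "a \<bullet> (A x + b) = adjoint A a \<bullet> x + a \<bullet> b" for x
      using adjoint_works[OF assms(1), of x a] by (metis inner_add_right inner_commute)
    ultimately have "{x. A x + b \<in> h} = {x. adjoint A a \<bullet> x \<le> c - a \<bullet> b}"
      by (auto simp: le_diff_eq)
    then show ?thesis by (simp add: polyhedron_halfspace_le)
  qed
  ultimately show ?thesis using F(1) by auto
qed

lemma face_of_affine_vimage:
  fixes A :: "'a::euclidean_space \<Rightarrow> 'b::euclidean_space"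
  assumes A: "linear A" and F: "F face_of S"
  shows "{x. A x + c \<in> F} face_of {x. A x + c \<in> S}"
  unfolding face_of_def
proof (intro conjI ballI impI)
  show "{x. A x + c \<in> F} \<subseteq> {x. A x + c \<in> S}" using F face_of_imp_subset by blast
  show "convex {x. A x + c \<in> F}"
    using face_of_imp_convex[OF F] A
    by (auto simp: convex_def affine_combination)
next
  fix a b x assume *: "a \<in> {x. A x + c \<in> S}" "b \<in> {x. A x + c \<in> S}" "x \<in> {x. A x + c \<in> F}"
    "x \<in> open_segment a b"
  then obtain u where u: "0 < u" "u < 1" "x = (1 - u) *\<^sub>R a + u *\<^sub>R b" by (auto simp: in_segment)
  then have x: "A x + c = (1 - u) *\<^sub>R (A a + c) + u *\<^sub>R (A b + c)"
    using affine_combination[OF A, of "1 - u" u a b c] by simp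
  \<comment> \<open>A may collapse the segment from a to b to one point. That point is then the
    image of x and lies in F; otherwise the face property of F applies to the image segment.\<close>
  have "A a + c \<in> F \<and> A b + c \<in> F"
  proof (cases "A a + c = A b + c")
    case True
    then have "A x + c = A a + c" unfolding x by (simp add: algebra_simps)
    then show ?thesis using * True by simp
  next
    case False
    then have "A x + c \<in> open_segment (A a + c) (A b + c)" using x u(1,2) by (auto simp: in_segment)
    then show ?thesis using F * unfolding face_of_def by blast
  qed
  then show "a \<in> {x. A x + c \<in> F}" "b \<in> {x. A x + c \<in> F}" by auto
qed

text \<open>By injectivity, an open segment in the image through a point of the image of F is the
  image of an open segment through a point of F.\<close>

lemma face_of_affine_linear_image:
  assumes f: "affine_linear_on T f" and T: "convex T" "inj_on f T" and F: "F face_of T"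
  shows "f ` F face_of f ` T"
proof -
  obtain A c where A: "linear A" and fA: "\<And>x. x \<in> T \<Longrightarrow> f x = A x + c"
    using f by (auto simp: affine_linear_on_def)
  have FT: "F \<subseteq> T" using F by (rule face_of_imp_subset)
  have comb: "f (u *\<^sub>R x + v *\<^sub>R y) = u *\<^sub>R f x + v *\<^sub>R f y" "u *\<^sub>R x + v *\<^sub>R y \<in> T"
    if "x \<in> T" "y \<in> T" "u \<ge> 0" "v \<ge> 0" "u + v = 1" for x y u v
    using that affine_combination[OF A, of u v x y c] fA convexD[OF T(1), of x y u v] by auto
  show ?thesis unfolding face_of_def
  proof (intro conjI ballI impI)
    show "f ` F \<subseteq> f ` T" using FT by blast
    show "convex (f ` F)"
      unfolding convex_def
    proof (intro ballI allI impI)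
      fix p q and u v :: real assume "p \<in> f ` F" "q \<in> f ` F" and uv: "0 \<le> u" "0 \<le> v" "u + v = 1"
      then obtain x y where xy: "x \<in> F" "y \<in> F" "p = f x" "q = f y" by blast
      then have "u *\<^sub>R x + v *\<^sub>R y \<in> F"
        using convexD[OF face_of_imp_convex[OF F]] uv by blast
      moreover have "u *\<^sub>R p + v *\<^sub>R q = f (u *\<^sub>R x + v *\<^sub>R y)"
        using comb(1)[of x y u v] xy uv FT by (metis subsetD)
      ultimately show "u *\<^sub>R p + v *\<^sub>R q \<in> f ` F" by blast
    qed
  next
    fix p q r assume "p \<in> f ` T" "q \<in> f ` T" "r \<in> f ` F" and seg: "r \<in> open_segment p q"
    then obtain x y z where xyz: "x \<in> T" "y \<in> T" "z \<in> F" "p = f x" "q = f y" "r = f z" by blast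
    obtain u where u: "0 < u" "u < 1" "r = (1 - u) *\<^sub>R p + u *\<^sub>R q" "p \<noteq> q"
      using seg by (auto simp: in_segment)
    then have "f z = f ((1 - u) *\<^sub>R x + u *\<^sub>R y)" "(1 - u) *\<^sub>R x + u *\<^sub>R y \<in> T"
      using comb[of x y "1 - u" u] xyz by auto
    then have "z = (1 - u) *\<^sub>R x + u *\<^sub>R y"
      using T(2) xyz FT by (auto dest: inj_onD)
    then have "z \<in> open_segment x y"
      using u xyz by (auto simp: in_segment)
    then have "x \<in> F \<and> y \<in> F" using F xyz unfolding face_of_def by blast
    then show "p \<in> f ` F" "q \<in> f ` F" using xyz by auto
  qed
qed

lemma polytope_affine_linear_image:
  fixes f :: "'a::euclidean_space \<Rightarrow> 'b::euclidean_space"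
  assumes "affine_linear_on T f" "polytope T"
  shows "polytope (f ` T)"
proof -
  obtain A c where A: "linear A" and fA: "\<And>x. x \<in> T \<Longrightarrow> f x = A x + c"
    using assms by (auto simp: affine_linear_on_def)
  have "f ` T = (+) c ` (A ` T)" using fA by (force simp: add.commute)
  then show ?thesis using polytope_linear_image[OF A assms(2)] by (simp add: polytope_translation_eq)
qed

section \<open>Piecewise linearity by polytopal cells; composition and inverse\<close>

lemma piecewise_linear_square_polytopes:
  assumes "piecewise_linear_square f"
  obtains \<T> where "finite \<T>" "\<Union>\<T> = square"
    "\<And>T. T \<in> \<T> \<Longrightarrow> polytope T \<and> affine_linear_on T f"
    "\<And>T T'. T \<in> \<T> \<Longrightarrow> T' \<in> \<T> \<Longrightarrow> T \<inter> T' face_of T"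
proof -
  obtain \<T> where \<T>: "triangulation \<T>" "\<Union>\<T> = square" "\<forall>T\<in>\<T>. affine_linear_on T f"
    using assms unfolding piecewise_linear_square_def affine_linear_on_def by blast
  show thesis
    by (rule that[of \<T>]) (use \<T> in \<open>auto simp: triangulation_def intro: simplex_imp_polytope\<close>)
qed

text \<open>A cell complex of polytopes has a simplicial subdivision. Common refinements, whose
  cells are rarely simplices, can therefore be used directly as evidence of piecewise
  linearity.\<close>

lemma piecewise_linear_square_if_polytopes:
  assumes "finite \<M>" "\<Union>\<M> = square"
    and poly: "\<And>T. T \<in> \<M> \<Longrightarrow> polytope T" and lin: "\<And>T. T \<in> \<M> \<Longrightarrow> affine_linear_on T f"
    and face: "\<And>T T'. T \<in> \<M> \<Longrightarrow> T' \<in> \<M> \<Longrightarrow> T \<inter> T' face_of T"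
  shows "piecewise_linear_square f"
proof -
  obtain \<T> where \<T>: "simplicial_complex \<T>" "\<Union>\<T> = \<Union>\<M>"
    "\<And>K. K \<in> \<T> \<Longrightarrow> \<exists>C. C \<in> \<M> \<and> K \<subseteq> C"
    using simplicial_subdivision_of_cell_complex[OF assms(1) poly face] by metis
  have "triangulation \<T>" using \<T>(1) by (auto simp: simplicial_complex_def triangulation_def)
  moreover have "affine_linear_on K f" if "K \<in> \<T>" for K
    using \<T>(3)[OF that] lin affine_linear_on_subset by blast
  ultimately show ?thesis
    using \<T>(2) assms(2) unfolding piecewise_linear_square_def affine_linear_on_def by metis
qed

text \<open>Each cell T of g is cut by the g-preimages of the cells S of f. On such a piece g is
  affine with image in S, where f is affine.\<close>

lemma piecewise_linear_square_compose:
  assumes f: "piecewise_linear_square f" and g: "piecewise_linear_square g"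
    and gsq: "g ` square \<subseteq> square"
  shows "piecewise_linear_square (f \<circ> g)"
proof -
  obtain \<S> where S: "finite \<S>" "\<Union>\<S> = square"
    "\<And>T. T \<in> \<S> \<Longrightarrow> polytope T \<and> affine_linear_on T f"
    "\<And>T T'. T \<in> \<S> \<Longrightarrow> T' \<in> \<S> \<Longrightarrow> T \<inter> T' face_of T"
    using piecewise_linear_square_polytopes[OF f] by metis
  obtain \<T> where T: "finite \<T>" "\<Union>\<T> = square"
    "\<And>T. T \<in> \<T> \<Longrightarrow> polytope T \<and> affine_linear_on T g"
    "\<And>T T'. T \<in> \<T> \<Longrightarrow> T' \<in> \<T> \<Longrightarrow> T \<inter> T' face_of T"
    using piecewise_linear_square_polytopes[OF g] by metis
  define cell where "cell = (\<lambda>(T, S). T \<inter> g -` S)"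
  show ?thesis
  proof (rule piecewise_linear_square_if_polytopes)
    show "finite (cell ` (\<T> \<times> \<S>))" using S T by simp
    show "\<Union>(cell ` (\<T> \<times> \<S>)) = square"
    proof (intro equalityI subsetI)
      fix x assume "x \<in> \<Union>(cell ` (\<T> \<times> \<S>))"
      then show "x \<in> square" using T(2) by (auto simp: cell_def)
    next
      fix x assume x: "x \<in> square"
      then obtain T1 where "T1 \<in> \<T>" "x \<in> T1" using T(2) by blast
      moreover obtain S1 where "S1 \<in> \<S>" "g x \<in> S1" using S(2) gsq x by blast
      ultimately show "x \<in> \<Union>(cell ` (\<T> \<times> \<S>))"
        by (intro UnionI[of "cell (T1, S1)"]) (auto simp: cell_def)
    qed
  next
    fix C assume "C \<in> cell ` (\<T> \<times> \<S>)"
    then obtain T1 S1 where C: "T1 \<in> \<T>" "S1 \<in> \<S>" "C = T1 \<inter> g -` S1" by (auto simp: cell_def)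
    obtain A c where A: "linear A" and gA: "\<And>x. x \<in> T1 \<Longrightarrow> g x = A x + c"
      using T(3)[OF C(1)] by (auto simp: affine_linear_on_def)
    have "C = T1 \<inter> {x. A x + c \<in> S1}" using gA C(3) by auto
    then show "polytope C"
      using polyhedron_affine_vimage[OF A polytope_imp_polyhedron] S(3) T(3) C
      by (simp add: polytope_Int_polyhedron)
    show "affine_linear_on C (f \<circ> g)"
    proof (rule affine_linear_on_compose)
      show "affine_linear_on C g"
        using T(3)[OF C(1)] C(3) affine_linear_on_subset[of T1 g C] by simp
      show "affine_linear_on (g ` C) f"
        using S(3)[OF C(2)] C(3) affine_linear_on_subset[of S1 f "g ` C"] by blast
    qed
  next
    fix C C' assume "C \<in> cell ` (\<T> \<times> \<S>)" "C' \<in> cell ` (\<T> \<times> \<S>)"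
    then obtain T1 S1 T2 S2 where C: "T1 \<in> \<T>" "S1 \<in> \<S>" "C = T1 \<inter> g -` S1"
      "T2 \<in> \<T>" "S2 \<in> \<S>" "C' = T2 \<inter> g -` S2" by (auto simp: cell_def)
    obtain A c where A: "linear A" and gA: "\<And>x. x \<in> T1 \<Longrightarrow> g x = A x + c"
      using T(3)[OF C(1)] by (auto simp: affine_linear_on_def)
    \<comment> \<open>The intersection of the two pieces lies in T1, so the affine formula for g on
      T1 serves for both. It is a face of T1 cut with the pullback of a face of S1.\<close>
    have "(T1 \<inter> T2) \<inter> {x. A x + c \<in> S1 \<inter> S2} face_of T1 \<inter> {x. A x + c \<in> S1}"
      by (intro face_of_Int_Int face_of_affine_vimage A S(4) T(4) C)
    moreover have "T1 \<inter> {x. A x + c \<in> S1} = C" "(T1 \<inter> T2) \<inter> {x. A x + c \<in> S1 \<inter> S2} = C \<inter> C'"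
      using gA C by auto
    ultimately show "C \<inter> C' face_of C" by simp
  qed
qed

text \<open>The f-images of the cells of f are cells for h; injectivity of f makes them intersect in
  images of faces.\<close>

lemma piecewise_linear_square_inverse:
  assumes f: "piecewise_linear_square f" and fsq: "f ` square = square"
    and inv: "\<And>x. x \<in> square \<Longrightarrow> h (f x) = x"
  shows "piecewise_linear_square h"
proof -
  obtain \<T> where T: "finite \<T>" "\<Union>\<T> = square"
    "\<And>T. T \<in> \<T> \<Longrightarrow> polytope T \<and> affine_linear_on T f"
    "\<And>T T'. T \<in> \<T> \<Longrightarrow> T' \<in> \<T> \<Longrightarrow> T \<inter> T' face_of T"
    using piecewise_linear_square_polytopes[OF f] by metis
  have inj: "inj_on f square" using inv by (rule inj_on_inverseI)
  have sub: "T \<subseteq> square" if "T \<in> \<T>" for T using T(2) that by blast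
  show ?thesis
  proof (rule piecewise_linear_square_if_polytopes)
    show "finite ((`) f ` \<T>)" using T by simp
    show "\<Union>((`) f ` \<T>) = square" using T(2) fsq by (metis image_Union)
  next
    fix C assume "C \<in> (`) f ` \<T>"
    then obtain T1 where C: "T1 \<in> \<T>" "C = f ` T1" by blast
    show "polytope C"
      unfolding C(2) using T(3)[OF C(1)] by (simp add: polytope_affine_linear_image)
    show "affine_linear_on C h"
      unfolding C(2) using T(3)[OF C(1)] sub[OF C(1)] inv
      by (intro affine_linear_on_inverse) (auto intro: polytope_imp_convex)
  next
    fix C C' assume "C \<in> (`) f ` \<T>" "C' \<in> (`) f ` \<T>"
    then obtain T1 T2 where C: "T1 \<in> \<T>" "T2 \<in> \<T>" "C = f ` T1" "C' = f ` T2" by blast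
    have "C \<inter> C' = f ` (T1 \<inter> T2)"
      using inj_on_image_Int[OF inj sub sub] C by simp
    moreover have "f ` (T1 \<inter> T2) face_of f ` T1"
      using T(3)[OF C(1)] T(4)[OF C(1,2)] inj_on_subset[OF inj sub[OF C(1)]]
      by (intro face_of_affine_linear_image) (simp_all add: polytope_imp_convex)
    ultimately show "C \<inter> C' face_of C" using C by simp
  qed
qed

section \<open>The group of PL homeomorphisms of the square\<close>

lemma square_eq_cbox: "square = cbox 0 1"
  by (auto simp: square_def mem_box_cart)

lemma square_boundary_eq: "square_boundary = square - box 0 1"
  by (simp add: square_boundary_def square_eq_cbox frontier_cbox)

lemma PL_square_fixes_outside:
  assumes "f \<in> PL_square_set" "z \<notin> box 0 1"
  shows "f z = z"
  using assms by (cases "z \<in> square") (auto simp: PL_square_set_def square_boundary_eq)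

lemma PL_square_image: "f \<in> PL_square_set \<Longrightarrow> f ` square = square"
  by (auto simp: PL_square_set_def homeomorphism_def)

lemma PL_square_bij:
  assumes f: "f \<in> PL_square_set"
  shows "bij f"
proof -
  obtain g where g: "homeomorphism square square f g" using f by (auto simp: PL_square_set_def)
  have "bij_betw f square square"
    using g by (metis bij_betw_def homeomorphism_def inj_on_inverseI)
  moreover have "bij_betw f (- square) (- square)"
    using f by (auto simp: PL_square_set_def bij_betw_def inj_on_def image_iff)
  ultimately have "bij_betw f (square \<union> - square) (square \<union> - square)"
    by (rule bij_betw_combine) auto
  then show ?thesis by simp
qed

text \<open>The plane is the union of two closed sets, the square and the complement of its
  interior, and f is the identity on the second.\<close>

lemma PL_square_continuous:
  assumes f: "f \<in> PL_square_set"
  shows "continuous_on UNIV f"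
proof -
  have "continuous_on square f" using f by (auto simp: PL_square_set_def homeomorphism_def)
  moreover have "continuous_on (- box 0 1) f"
    by (rule continuous_on_eq[of _ id]) (use PL_square_fixes_outside[OF f] in auto)
  ultimately have "continuous_on (square \<union> - box 0 1) f"
    by (intro continuous_on_closed_Un) (auto simp: square_eq_cbox closed_Compl)
  moreover have "square \<union> - box 0 1 = UNIV" using box_subset_cbox by (auto simp: square_eq_cbox)
  ultimately show ?thesis by simp
qed

lemma PL_square_closed_fixed: 
  assumes f: "f \<in> PL_square_set"
  shows "closed {z. f z = z}"
  by (rule closed_Collect_eq) (auto intro: PL_square_continuous[OF f])

lemma PL_square_compose:
  assumes f: "f \<in> PL_square_set" and g: "g \<in> PL_square_set"
  shows "f \<circ> g \<in> PL_square_set"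
proof -
  obtain f' g' where "homeomorphism square square f f'" "homeomorphism square square g g'"
    using f g by (auto simp: PL_square_set_def)
  then have "homeomorphism square square (f \<circ> g) (g' \<circ> f')"
    using homeomorphism_compose by blast
  moreover have "piecewise_linear_square (f \<circ> g)"
    using piecewise_linear_square_compose[of f g] PL_square_image[OF g] f g
    by (auto simp: PL_square_set_def)
  ultimately show ?thesis using f g by (auto simp: PL_square_set_def)
qed

lemma PL_square_inverse:
  assumes f: "f \<in> PL_square_set"
  shows "inv_into UNIV f \<in> PL_square_set"
proof -
  let ?h = "inv_into UNIV f"
  have inv: "?h (f x) = x" for x using PL_square_bij[OF f] by (simp add: bij_is_inj)
  have fixed: "?h z = z" if "f z = z" for z using inv[of z] that by simp
  obtain g where g: "homeomorphism square square f g" using f by (auto simp: PL_square_set_def)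
  have "homeomorphism square square ?h f"
  proof (rule homeomorphism_cong[OF homeomorphism_symD[OF g]])
    show "?h x = g x" if "x \<in> square" for x
      using inv[of "g x"] g that by (simp add: homeomorphism_def)
  qed auto
  moreover have "piecewise_linear_square ?h"
    by (rule piecewise_linear_square_inverse[of f])
      (use f PL_square_image[OF f] inv in \<open>auto simp: PL_square_set_def\<close>)
  ultimately show ?thesis using f fixed by (auto simp: PL_square_set_def)
qed

lemma PL_square_id: "id \<in> PL_square_set"
proof -
  have "piecewise_linear_square id"
  proof (rule piecewise_linear_square_if_polytopes[of "{square}"])
    show "affine_linear_on T id" for T :: "(real^2) set"
      unfolding affine_linear_on_def by (intro exI[of _ id] exI[of _ 0]) (auto simp: linear_id)
  qed (auto simp: square_eq_cbox polytope_interval face_of_refl)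
  then show ?thesis
    by (auto simp: PL_square_set_def homeomorphism_ident[unfolded id_def[symmetric]] intro!: exI[of _ id])
qed

lemma PL_square_simps [simp]:
  "carrier PL_square = PL_square_set" "mult PL_square = (\<circ>)" "\<one>\<^bsub>PL_square\<^esub> = id"
  by (simp_all add: PL_square_def)

lemma group_PL_square: "group PL_square"
proof (rule groupI)
  fix f assume "f \<in> carrier PL_square"
  then show "\<exists>g\<in>carrier PL_square. g \<otimes>\<^bsub>PL_square\<^esub> f = \<one>\<^bsub>PL_square\<^esub>"
    using PL_square_inverse[of f] PL_square_bij[of f]
    by (intro bexI[of _ "inv_into UNIV f"]) (auto simp: bij_is_inj)
qed (auto simp: PL_square_compose PL_square_id comp_assoc)

lemma PL_square_inv: "f \<in> PL_square_set \<Longrightarrow> m_inv PL_square f = inv_into UNIV f"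
  by (rule group.inv_equality[OF group_PL_square])
    (auto simp: PL_square_inverse bij_is_inj PL_square_bij)

text \<open>This carries equations between continuous maps, such as f z = z, from an open region to
  its boundary.\<close>

lemma closed_contains_ray_origin:
  fixes z v :: "'a::real_normed_vector"
  assumes "closed S" "e > 0" "\<And>r. 0 < r \<Longrightarrow> r < e \<Longrightarrow> z + r *\<^sub>R v \<in> S"
  shows "z \<in> S"
proof (rule Lim_in_closed_set[OF assms(1), of _ "at_right 0"])
  show "eventually (\<lambda>r. z + r *\<^sub>R v \<in> S) (at_right (0::real))"
    using assms(2,3) eventually_at_right_real[OF assms(2)] by (auto elim: eventually_mono)
  have "((\<lambda>r. z + r *\<^sub>R v) \<longlongrightarrow> z + 0 *\<^sub>R v) (at_right (0::real))"
    by (intro tendsto_intros)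
  then show "((\<lambda>r. z + r *\<^sub>R v) \<longlongrightarrow> z) (at_right (0::real))" by simp
qed simp

section \<open>Germs along rays\<close>

text \<open>The height is measured vertically above the line through (t, a) with slope b, not
  perpendicularly, so a vertical shift changes it by exactly its own length.\<close>

definition height :: "real \<Rightarrow> real \<Rightarrow> real \<Rightarrow> real^2 \<Rightarrow> real" where
  "height t a b z = z $ 2 - a - b * (z $ 1 - t)"

text \<open>The part of the open strip t < x < t + \<delta> lying below the line that leaves the
  start point of the ray with slope b + \<delta>.\<close>
definition wedge :: "real \<Rightarrow> real \<Rightarrow> real \<Rightarrow> real \<Rightarrow> (real^2) set" where
  "wedge t a b \<delta> = {z. 0 < z $ 1 - t \<and> z $ 1 - t < \<delta> \<and> height t a b z < \<delta> * (z $ 1 - t)}"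

text \<open>The \<open>max 0\<close> joins two regimes in one formula: the identity on and below the
  ray, a shear above it. The value w = 0 is allowed, so that the maps with a germ at a given ray are
  closed under composition and inverse; the width \<delta> may depend on f.\<close>

fun has_germ :: "real \<times> real \<times> real \<Rightarrow> (real^2 \<Rightarrow> real^2) \<Rightarrow> real^2 \<Rightarrow> bool" where
  "has_germ (t, a, b) f w \<longleftrightarrow> (\<forall>z. z $ 1 \<le> t \<longrightarrow> f z = z) \<and>
     (\<exists>\<delta>>0. \<forall>z\<in>wedge t a b \<delta>. f z = z + max 0 (height t a b z) *\<^sub>R w)"

text \<open>The factor \<lambda> by which the shear z \<mapsto> z + height z w scales the height.\<close>
fun multiplier :: "real \<times> real \<times> real \<Rightarrow> real^2 \<Rightarrow> real" where
  "multiplier (t, a, b) w = 1 + w $ 2 - b * w $ 1"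

fun place_less :: "real \<times> real \<times> real \<Rightarrow> real \<times> real \<times> real \<Rightarrow> bool" where
  "place_less (t, a, b) (t', a', b') \<longleftrightarrow> t < t' \<or> t = t' \<and> (a < a' \<or> a = a' \<and> b < b')"

section \<open>The order of rays and the shape of wedges\<close>

lemma place_less_trans: "place_less P Q \<Longrightarrow> place_less Q R \<Longrightarrow> place_less P R"
  by (cases P; cases Q; cases R) auto

lemma place_less_irrefl: "\<not> place_less P P"
  by (cases P) auto

lemma place_less_linear: "place_less P Q \<or> P = Q \<or> place_less Q P"
  by (cases P; cases Q) auto

lemma place_finite_bound:
  assumes "finite A" "A \<noteq> {}"
  shows "\<exists>m\<in>A. \<forall>x\<in>A. x = m \<or> place_less m x" "\<exists>m\<in>A. \<forall>x\<in>A. x = m \<or> place_less x m"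
proof -
  have *: "asymp_on A place_less" "transp_on A place_less"
    by (auto intro!: asymp_onI transp_onI dest: place_less_trans simp: place_less_irrefl)
  show "\<exists>m\<in>A. \<forall>x\<in>A. x = m \<or> place_less m x"
    using Finite_Set.bex_min_element[OF assms(1) * assms(2)] place_less_linear by blast
  show "\<exists>m\<in>A. \<forall>x\<in>A. x = m \<or> place_less x m"
    using Finite_Set.bex_max_element[OF assms(1) * assms(2)] place_less_linear by blast
qed

text \<open>If a < a', the initial gap outweighs the slopes for small s; if a = a', the gap is (b' -
  b) s. A gap linear in s is what makes a thin wedge around the lower ray stay below the upper
  one.\<close>

lemma place_less_gap:
  assumes "place_less (t, a, b) (t, a', b')"
  shows "\<exists>\<delta>>0. \<forall>s. 0 < s \<and> s < \<delta> \<longrightarrow> a + b * s + \<delta> * s \<le> a' + b' * s"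
proof (cases "a < a'")
  case True
  \<comment> \<open>K bounds the rate b - b' + \<delta> for every \<delta> up to 1, so s K \<le> a'
    - a is enough.\<close>
  define K where "K = \<bar>b\<bar> + \<bar>b'\<bar> + 1"
  define \<delta> where "\<delta> = min 1 ((a' - a) / K)"
  have K: "K > 0" by (simp add: K_def)
  have d: "\<delta> > 0" "\<delta> \<le> 1" "\<delta> \<le> (a' - a) / K" using True K by (auto simp: \<delta>_def)
  have "a + b * s + \<delta> * s \<le> a' + b' * s" if "0 < s" "s < \<delta>" for s
  proof -
    have "s * K \<le> a' - a"
      using that d K by (auto simp: pos_le_divide_eq[symmetric])
    moreover have "(b - b' + \<delta>) * s \<le> K * s"
      using that d by (intro mult_right_mono) (auto simp: K_def)
    ultimately show ?thesis by (simp add: algebra_simps)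
  qed
  then show ?thesis using d(1) by blast
next
  case False
  then have "a = a'" "b < b'" using assms by auto
  then show ?thesis
    by (intro exI[of _ "b' - b"]) (auto simp: algebra_simps)
qed

lemma wedge_mono: "\<delta> \<le> \<delta>' \<Longrightarrow> wedge t a b \<delta> \<subseteq> wedge t a b \<delta>'"
  by (auto simp: wedge_def) (smt (verit) mult_right_mono)

lemma wedge_inhabited:
  assumes "\<delta> > 0"
  shows "\<exists>z\<in>wedge t a b \<delta>. height t a b z > 0"
proof
  define s where "s = \<delta> / 2"
  define z :: "real^2" where "z = (\<chi> i. if i = 1 then t + s else a + b * s + (\<delta> / 2) * s)"
  have z: "z $ 1 = t + s" "z $ 2 = a + b * s + (\<delta> / 2) * s"
    by (auto simp: z_def)
  show "z \<in> wedge t a b \<delta>" "height t a b z > 0"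
    using assms by (auto simp: wedge_def height_def z s_def)
qed

lemma height_shear:
  "height t a b (z + m *\<^sub>R w) = height t a b z + m * (multiplier (t, a, b) w - 1)"
  by (simp add: height_def algebra_simps)

text \<open>In a thin wedge a point at horizontal distance s has height below \<delta>' s, so the
  shear changes its position and its height by small multiples of s only.\<close>

lemma shear_wedge_into_wedge:
  assumes "\<delta> > 0"
  shows "\<exists>\<delta>'>0. \<delta>' \<le> \<delta> \<and>
    (\<forall>z\<in>wedge t a b \<delta>'. z + max 0 (height t a b z) *\<^sub>R w \<in> wedge t a b \<delta>)"
proof -
  define \<mu> where "\<mu> = multiplier (t, a, b) w - 1"
  \<comment> \<open>K dominates the horizontal speed of the shear and the growth of the height. The
    two bounds on \<delta>' then keep the displacement below s / 4 and the new height below \<delta>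
    s / 4.\<close>
  define K where "K = 1 + \<bar>w $ 1\<bar> + \<bar>\<mu>\<bar>"
  have K: "K \<ge> 1" "\<bar>w $ 1\<bar> \<le> K" "1 + \<bar>\<mu>\<bar> \<le> K" by (auto simp: K_def)
  define \<delta>' where "\<delta>' = min (1 / (4 * K)) (\<delta> / (4 * K))"
  have d: "\<delta>' > 0" "\<delta>' * (4 * K) \<le> 1" "\<delta>' * (4 * K) \<le> \<delta>"
    using K assms by (auto simp: \<delta>'_def min_def field_simps)
  have d4: "4 * \<delta>' \<le> \<delta>"
  proof -
    have "\<delta>' * (4 * 1) \<le> \<delta>' * (4 * K)" using d K by (intro mult_left_mono) auto
    then show ?thesis using d by linarith
  qed
  have "z + max 0 (height t a b z) *\<^sub>R w \<in> wedge t a b \<delta>" if z: "z \<in> wedge t a b \<delta>'" for z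
  proof -
    define s where "s = z $ 1 - t"
    define m where "m = max 0 (height t a b z)"
    have s: "0 < s" "s < \<delta>'" "height t a b z < \<delta>' * s"
      using z by (auto simp: wedge_def s_def)
    have m: "0 \<le> m" "m \<le> \<delta>' * s" using s d by (auto simp: m_def)
    have mK: "m * K \<le> \<delta>' * s * K" using m K by (intro mult_right_mono) auto
    have "\<delta>' * (4 * K) * s \<le> 1 * s" "\<delta>' * (4 * K) * s \<le> \<delta> * s"
      using d s by (intro mult_right_mono; simp)+
    then have mK': "4 * (m * K) \<le> s" "4 * (m * K) \<le> \<delta> * s"
      using mK by (auto simp: algebra_simps)
    have "\<bar>m * w $ 1\<bar> \<le> m * K"
      using m K by (simp add: abs_mult mult_left_mono)
    then have mw: "4 * \<bar>m * w $ 1\<bar> \<le> s" using mK' by linarith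
    have "m * (1 + \<bar>\<mu>\<bar>) \<le> m * K" using m K by (intro mult_left_mono) auto
    moreover have "m * \<mu> \<le> m * \<bar>\<mu>\<bar>" using m by (intro mult_left_mono) auto
    ultimately have "m + m * \<mu> \<le> m * K" by (simp add: algebra_simps)
    moreover have "height t a b z \<le> m" by (simp add: m_def)
    ultimately have "4 * (height t a b z + m * \<mu>) \<le> \<delta> * s"
      using mK' by argo
    then have h: "4 * height t a b (z + m *\<^sub>R w) \<le> \<delta> * s"
      by (simp only: height_shear \<mu>_def)
    have "\<delta> * s < \<delta> * (4 * (s + m * w $ 1))"
      using assms mw s by (intro mult_strict_left_mono) auto
    then have "height t a b (z + m *\<^sub>R w) < \<delta> * (s + m * w $ 1)"
      using h by (simp add: algebra_simps)
    then show ?thesis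
      unfolding m_def[symmetric] wedge_def
      using mw s d4 by (auto simp: s_def algebra_simps)
  qed
  then show ?thesis using d(1) d4 by (intro exI[of _ \<delta>']) auto
qed

text \<open>A thin wedge at the earlier ray contains only points before Q: points to the left of the
  line x = t', or, when both rays start on the same vertical line, points below the ray of Q by the
  linear gap. There f is the identity.\<close>

lemma has_germ_mono:
  assumes "place_less P Q" "has_germ Q f w"
  shows "has_germ P f 0"
proof -
  obtain t a b where P: "P = (t, a, b)" by (cases P)
  obtain t' a' b' where Q: "Q = (t', a', b')" by (cases Q)
  obtain \<delta> where \<delta>: "\<delta> > 0"
    "\<And>z. z \<in> wedge t' a' b' \<delta> \<Longrightarrow> f z = z + max 0 (height t' a' b' z) *\<^sub>R w"
    and fix_left: "\<And>z. z $ 1 \<le> t' \<Longrightarrow> f z = z"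
    using assms(2) by (auto simp: Q)
  have "\<exists>\<delta>>0. \<forall>z\<in>wedge t a b \<delta>. f z = z"
  proof (cases "t < t'")
    case True
    then show ?thesis
      by (intro exI[of _ "t' - t"]) (auto simp: wedge_def fix_left)
  next
    case False
    then have t: "t' = t" "place_less (t, a, b) (t, a', b')"
      using assms(1) by (auto simp: P Q)
    obtain \<epsilon> where e: "\<epsilon> > 0" "\<forall>s. 0 < s \<and> s < \<epsilon> \<longrightarrow> a + b * s + \<epsilon> * s \<le> a' + b' * s"
      using place_less_gap[OF t(2)] by blast
    have "f z = z" if z: "z \<in> wedge t a b (min \<delta> \<epsilon>)" for z
    proof -
      define s where "s = z $ 1 - t"
      have s: "0 < s" "s < \<delta>" "s < \<epsilon>" "height t a b z < \<epsilon> * s"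
        using z wedge_mono[of "min \<delta> \<epsilon>" \<epsilon> t a b] by (auto simp: wedge_def s_def)
      have "height t' a' b' z < 0"
        using e(2)[rule_format, of s] s by (simp add: height_def t s_def)
      moreover have "z \<in> wedge t' a' b' \<delta>"
        unfolding wedge_def t mem_Collect_eq s_def[symmetric]
        using \<open>height t' a' b' z < 0\<close> s less_trans[OF _ mult_pos_pos[OF \<delta>(1) s(1)]]
        by (simp add: t(1))
      ultimately show ?thesis using \<delta>(2)[of z] by simp
    qed
    then show ?thesis using \<delta>(1) e(1) by (intro exI[of _ "min \<delta> \<epsilon>"]) auto
  qed
  then show ?thesis using fix_left assms(1) by (auto simp: P Q)
qed

section \<open>The group law on germs\<close>

lemma has_germ_id: "has_germ P id 0"
  by (cases P) (auto intro: exI[of _ 1])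

lemma has_germ_unique:
  assumes "has_germ P f w" "has_germ P f w'"
  shows "w = w'"
proof -
  obtain t a b where P: "P = (t, a, b)" by (cases P)
  obtain \<delta> \<delta>' where d: "\<delta> > 0" "\<delta>' > 0"
    "\<forall>z\<in>wedge t a b \<delta>. f z = z + max 0 (height t a b z) *\<^sub>R w"
    "\<forall>z\<in>wedge t a b \<delta>'. f z = z + max 0 (height t a b z) *\<^sub>R w'"
    using assms by (auto simp: P)
  obtain z where z: "z \<in> wedge t a b (min \<delta> \<delta>')" "height t a b z > 0"
    using wedge_inhabited[of "min \<delta> \<delta>'" t a b] d by auto
  have "z \<in> wedge t a b \<delta>" "z \<in> wedge t a b \<delta>'"
    using z wedge_mono[of "min \<delta> \<delta>'"] by (meson min.cobounded1 min.cobounded2 subsetD)+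
  then have "max 0 (height t a b z) *\<^sub>R w = max 0 (height t a b z) *\<^sub>R w'"
    using d by (metis add_left_cancel)
  then show ?thesis using z by simp
qed

text \<open>Otherwise a point z just above the ray is sent to a point of the wedge on or below the
  ray, which f fixes. Injectivity gives f z = z, hence w = 0 and multiplier 1.\<close>

lemma multiplier_pos:
  assumes "has_germ P f w" "inj f"
  shows "multiplier P w > 0"
proof (rule ccontr)
  assume neg: "\<not> multiplier P w > 0"
  obtain t a b where P: "P = (t, a, b)" by (cases P)
  obtain \<delta> where d: "\<delta> > 0" "\<forall>z\<in>wedge t a b \<delta>. f z = z + max 0 (height t a b z) *\<^sub>R w"
    using assms by (auto simp: P)
  obtain \<delta>' where d': "\<delta>' > 0" "\<delta>' \<le> \<delta>"
    "\<forall>z\<in>wedge t a b \<delta>'. z + max 0 (height t a b z) *\<^sub>R w \<in> wedge t a b \<delta>"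
    using shear_wedge_into_wedge[OF d(1)] by blast
  obtain z where z: "z \<in> wedge t a b \<delta>'" "height t a b z > 0"
    using wedge_inhabited[OF d'(1)] by blast
  have fz: "f z = z + height t a b z *\<^sub>R w" "f z \<in> wedge t a b \<delta>"
    using d(2) d'(3) z wedge_mono[OF d'(2), of t a b] by (metis less_imp_le max.absorb2 subsetD)+
  have "height t a b (f z) = height t a b z * multiplier P w"
    unfolding fz(1) height_shear P by (simp add: algebra_simps)
  also have "\<dots> \<le> 0" using z neg by (simp add: mult_nonneg_nonpos)
  finally have "f (f z) = f z" using d(2) fz(2) by simp
  then have "f z = z" using assms(2) by (simp add: inj_eq)
  then have "w = 0" using fz z by simp
  then show False using neg by (simp add: P)
qed

text \<open>The map g multiplies the height by its multiplier, so the later displacement by f is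
  that multiple of v. This is the product in the affine group.\<close>

lemma has_germ_comp:
  assumes f: "has_germ P f v" and g: "has_germ P g w" and "inj g"
  shows "has_germ P (f \<circ> g) (w + multiplier P w *\<^sub>R v)"
proof -
  obtain t a b where P: "P = (t, a, b)" by (cases P)
  obtain \<delta> \<epsilon> where d: "\<delta> > 0" "\<epsilon> > 0"
    "\<forall>z\<in>wedge t a b \<delta>. f z = z + max 0 (height t a b z) *\<^sub>R v"
    "\<forall>z\<in>wedge t a b \<epsilon>. g z = z + max 0 (height t a b z) *\<^sub>R w"
    using f g by (auto simp: P)
  obtain \<delta>' where d': "\<delta>' > 0" "\<delta>' \<le> \<delta>"
    "\<forall>z\<in>wedge t a b \<delta>'. z + max 0 (height t a b z) *\<^sub>R w \<in> wedge t a b \<delta>"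
    using shear_wedge_into_wedge[OF d(1)] by blast
  have pos: "multiplier P w > 0" by (rule multiplier_pos[OF g \<open>inj g\<close>])
  have "(f \<circ> g) z = z + max 0 (height t a b z) *\<^sub>R (w + multiplier P w *\<^sub>R v)"
    if "z \<in> wedge t a b (min \<delta>' \<epsilon>)" for z
  proof -
    have z: "z \<in> wedge t a b \<delta>'" "z \<in> wedge t a b \<epsilon>"
      using that wedge_mono[of "min \<delta>' \<epsilon>"] by (meson min.cobounded1 min.cobounded2 subsetD)+
    define m where "m = max 0 (height t a b z)"
    have gz: "g z = z + m *\<^sub>R w" "g z \<in> wedge t a b \<delta>"
      using d d' z by (auto simp: m_def)
    \<comment> \<open>Positivity of the multiplier lets the scaling commute with
      \<open>max 0\<close>.\<close>
    have "max 0 (height t a b (g z)) = m * multiplier P w"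
    proof (cases "height t a b z > 0")
      case True
      then have "height t a b (g z) = m * multiplier P w"
        unfolding gz(1) height_shear P by (simp add: algebra_simps m_def)
      then show ?thesis using True pos by (simp add: m_def)
    next
      case False
      then show ?thesis unfolding gz(1) by (simp add: m_def)
    qed
    then show ?thesis using d(3) gz by (simp add: m_def[symmetric] scaleR_add_right)
  qed
  then show ?thesis using d d' f g
    by (auto simp: P intro!: exI[of _ "min \<delta>' \<epsilon>"])
qed

text \<open>The candidate preimage y of z is checked by computing f y = z inside a wedge small
  enough for y to stay where f is known.\<close>

lemma has_germ_inv:
  assumes f: "has_germ P f w" and "bij f"
  shows "has_germ P (inv_into UNIV f) (- (1 / multiplier P w) *\<^sub>R w)"
proof -
  obtain t a b where P: "P = (t, a, b)" by (cases P)
  have "inj f" using \<open>bij f\<close> by (rule bij_is_inj)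
  obtain \<delta> where d: "\<delta> > 0" "\<forall>z\<in>wedge t a b \<delta>. f z = z + max 0 (height t a b z) *\<^sub>R w"
    using assms by (auto simp: P)
  \<comment> \<open>This is the solution of v + w / \<lambda> = 0, where \<lambda> is the multiplier
    of w: y has height m / \<lambda>, so f adds back (m / \<lambda>) w.\<close>
  define v where "v = - (1 / multiplier P w) *\<^sub>R w"
  obtain \<delta>' where d': "\<delta>' > 0" "\<delta>' \<le> \<delta>"
    "\<forall>z\<in>wedge t a b \<delta>'. z + max 0 (height t a b z) *\<^sub>R v \<in> wedge t a b \<delta>"
    using shear_wedge_into_wedge[OF d(1)] by blast
  have pos: "multiplier P w > 0" by (rule multiplier_pos[OF f \<open>inj f\<close>])
  have mv: "multiplier P v = 1 / multiplier P w"
  proof -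
    have "multiplier P v = 1 - (1 / multiplier P w) * (multiplier P w - 1)"
      unfolding P v_def by (simp add: right_diff_distrib)
    then show ?thesis using pos by (simp add: right_diff_distrib)
  qed
  have "inv_into UNIV f z = z + max 0 (height t a b z) *\<^sub>R v" if z: "z \<in> wedge t a b \<delta>'" for z
  proof -
    define m where "m = max 0 (height t a b z)"
    define y where "y = z + m *\<^sub>R v"
    have y: "y \<in> wedge t a b \<delta>" using d' z by (simp add: y_def m_def)
    have hy: "max 0 (height t a b y) = m / multiplier P w"
    proof (cases "height t a b z > 0")
      case True
      then have "height t a b y = m * multiplier P v"
        unfolding y_def height_shear P by (simp add: algebra_simps m_def)
      then show ?thesis using True pos by (simp add: m_def mv)
    next
      case False
      then show ?thesis unfolding y_def by (simp add: m_def)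
    qed
    have "f y = y + (m / multiplier P w) *\<^sub>R w" using d y hy by simp
    also have "\<dots> = z" by (simp add: y_def v_def)
    finally show ?thesis using \<open>inj f\<close> by (metis inv_f_f y_def m_def)
  qed
  moreover have "inv_into UNIV f z = z" if "z $ 1 \<le> t" for z
    using f that \<open>inj f\<close> by (auto simp: P) (metis inv_f_f)
  ultimately show ?thesis using d' by (auto simp: P v_def)
qed

text \<open>The multiplier is the linear part in the affine group, so its logarithm is
  additive.\<close>

lemma multiplier_comp:
  "multiplier P (w + multiplier P w *\<^sub>R v) = multiplier P v * multiplier P w"
  by (cases P) (simp add: algebra_simps)

section \<open>The first ray moved by a piecewise linear map\<close>

lemma polytope_halfspaces:
  fixes T :: "'a::euclidean_space set"
  assumes "polytope T"
  shows "\<exists>C. finite C \<and> (\<forall>(c, d)\<in>C. c \<noteq> 0) \<and> T = {z. \<forall>(c, d)\<in>C. c \<bullet> z \<le> d}"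
proof -
  obtain F where F: "finite F" "T = \<Inter>F" "\<And>h. h \<in> F \<Longrightarrow> \<exists>a b. a \<noteq> 0 \<and> h = {x. a \<bullet> x \<le> b}"
    using polytope_imp_polyhedron[OF assms] unfolding polyhedron_def by blast
  then obtain a b where ab: "\<And>h. h \<in> F \<Longrightarrow> a h \<noteq> 0 \<and> h = {x. a h \<bullet> x \<le> b h}"
    by metis
  have "T = {z. \<forall>h\<in>F. a h \<bullet> z \<le> b h}"
    using F(2) ab by auto
  then show ?thesis
    using F(1) ab by (intro exI[of _ "(\<lambda>h. (a h, b h)) ` F"]) auto
qed

text \<open>A set R split by no bounding line is contained in or disjoint from each cell: either it
  satisfies all inequalities of the cell, or it violates one of them everywhere. One point of R then
  decides which cell, if any, contains all of R.\<close>

lemma PL_square_affine_chambers: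
  assumes f: "f \<in> PL_square_set"
  obtains C where "finite C" "\<And>c d. (c, d) \<in> C \<Longrightarrow> c \<noteq> 0"
    "\<And>R. R \<noteq> {} \<Longrightarrow> (\<And>c d. (c, d) \<in> C \<Longrightarrow> (\<forall>z\<in>R. c \<bullet> z \<le> d) \<or> (\<forall>z\<in>R. \<not> c \<bullet> z \<le> d))
      \<Longrightarrow> affine_linear_on R f"
proof -
  have "piecewise_linear_square f" using f by (auto simp: PL_square_set_def)
  then obtain \<T> where T: "finite \<T>" "\<Union>\<T> = square"
    "\<And>T. T \<in> \<T> \<Longrightarrow> polytope T \<and> affine_linear_on T f"
    by (rule piecewise_linear_square_polytopes) metis
  have "polytope T" if "T \<in> insert square \<T>" for T
    using that T(3) by (auto simp: square_eq_cbox polytope_interval)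
  then have "\<forall>T\<in>insert square \<T>. \<exists>C. finite C \<and> (\<forall>(c, d)\<in>C. c \<noteq> 0) \<and> T = {z. \<forall>(c, d)\<in>C. c \<bullet> z \<le> d}"
    by (intro ballI polytope_halfspaces) simp
  from bchoice[OF this] obtain H where
    HT: "\<forall>T\<in>insert square \<T>. finite (H T) \<and> (\<forall>(c, d)\<in>H T. c \<noteq> 0) \<and> T = {z. \<forall>(c, d)\<in>H T. c \<bullet> z \<le> d}"
    by (rule exE)
  have H: "finite (H T)" "\<forall>(c, d)\<in>H T. c \<noteq> 0" "T = {z. \<forall>(c, d)\<in>H T. c \<bullet> z \<le> d}"
    if "T \<in> insert square \<T>" for T
    by (rule bspec[OF HT that, THEN conjunct1], rule bspec[OF HT that, THEN conjunct2, THEN conjunct1],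
        rule bspec[OF HT that, THEN conjunct2, THEN conjunct2])
  \<comment> \<open>The inequalities of the square itself are included so that R cannot lie partly
    outside it, where f is the identity.\<close>
  define C where "C = \<Union>(H ` insert square \<T>)"
  have "affine_linear_on R f"
    if "R \<noteq> {}" and R: "\<And>c d. (c, d) \<in> C \<Longrightarrow> (\<forall>z\<in>R. c \<bullet> z \<le> d) \<or> (\<forall>z\<in>R. \<not> c \<bullet> z \<le> d)" for R
  proof -
    have alt: "R \<subseteq> T \<or> R \<inter> T = {}" if T: "T \<in> insert square \<T>" for T
    proof (cases "\<forall>(c, d)\<in>H T. \<forall>z\<in>R. c \<bullet> z \<le> d")
      case True
      then show ?thesis by (subst (1) H(3)[OF T]) auto
    next
      case False
      then obtain c d where cd: "(c, d) \<in> H T" "\<not> (\<forall>z\<in>R. c \<bullet> z \<le> d)" by auto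
      moreover have "(c, d) \<in> C" using cd(1) T by (auto simp: C_def)
      ultimately have "\<forall>z\<in>R. \<not> c \<bullet> z \<le> d" using R by blast
      moreover have "c \<bullet> z \<le> d" if "z \<in> T" for z
        using that cd(1) H(3)[OF T] by auto
      ultimately show ?thesis by blast
    qed
    obtain z where z: "z \<in> R" using \<open>R \<noteq> {}\<close> by blast
    show ?thesis
    proof (cases "z \<in> square")
      case True
      then obtain T1 where "T1 \<in> \<T>" "z \<in> T1" using T(2) by blast
      then have "R \<subseteq> T1" "affine_linear_on T1 f" using alt[of T1] T(3) z by auto
      then show ?thesis using affine_linear_on_subset by blast
    next
      case False
      then have "R \<inter> square = {}" using alt[of square] z by auto
      then have "\<forall>x\<in>R. f x = x" using f by (auto simp: PL_square_set_def)
      then show ?thesis unfolding affine_linear_on_def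
        by (intro exI[of _ id] exI[of _ 0]) (auto simp: linear_id)
    qed
  qed
  moreover have "finite C" using T(1) H(1) unfolding C_def by (intro finite_Union) auto
  moreover have "c \<noteq> 0" if "(c, d) \<in> C" for c d using that H(2) unfolding C_def by fastforce
  ultimately show thesis using that by blast
qed

section \<open>Bounding lines near a vertical line\<close>

lemma finite_common_bound:
  fixes P :: "'a \<Rightarrow> real \<Rightarrow> bool"
  assumes "finite X" "\<And>x. x \<in> X \<Longrightarrow> \<exists>\<delta>>0. P x \<delta>"
    and mono: "\<And>x \<delta> \<epsilon>. P x \<delta> \<Longrightarrow> 0 < \<epsilon> \<Longrightarrow> \<epsilon> \<le> \<delta> \<Longrightarrow> P x \<epsilon>"
  shows "\<exists>\<delta>>0. \<forall>x\<in>X. P x \<delta>"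
  using assms(1,2)
proof induction
  case empty
  show ?case by (intro exI[of _ 1]) auto
next
  case (insert x X)
  then obtain d e where de: "d > 0" "\<forall>x\<in>X. P x d" "e > 0" "P x e" by (metis insertCI)
  have "min d e > 0" "min d e \<le> d" "min d e \<le> e" using de by auto
  then have "\<forall>y\<in>insert x X. P y (min d e)" using de mono by (metis insertE)
  then show ?case using \<open>min d e > 0\<close> by blast
qed

lemma height_axis:
  "height t a b (z + r *\<^sub>R axis 2 1) = height t a b z + r"
  "(z + r *\<^sub>R axis 2 1) $ 1 = (z :: real^2) $ 1"
  by (simp_all add: height_def axis_def)

text \<open>A non-vertical line c \<bullet> z = d is the line of a ray at x = t: its intercept there
  and its slope are the two arguments of \<open>height\<close>. The side of the line is thus read
  off from the sign of the height.\<close>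

lemma inner_eq_height:
  fixes c z :: "real^2"
  assumes "c $ 2 \<noteq> 0"
  shows "c \<bullet> z - d = c $ 2 * height t ((d - c $ 1 * t) / c $ 2) (- c $ 1 / c $ 2) z"
  using assms by (simp add: inner_vec_def sum_2 height_def field_simps)

lemma halfspace_dichotomy:
  fixes R :: "(real^2) set"
  assumes "k \<noteq> 0" "(\<forall>z\<in>R. h z > 0) \<or> (\<forall>z\<in>R. h z < 0)" "\<And>z. z \<in> R \<Longrightarrow> c \<bullet> z - d = k * h z"
  shows "(\<forall>z\<in>R. c \<bullet> z \<le> d) \<or> (\<forall>z\<in>R. \<not> c \<bullet> z \<le> d)"
proof -
  have *: "c \<bullet> z \<le> d \<longleftrightarrow> k * h z \<le> 0" if "z \<in> R" for z using assms(3)[OF that] by linarith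
  show ?thesis
    using assms(1,2) * by (cases "k > 0") (fastforce simp: mult_le_0_iff)+
qed

text \<open>t is the infimum of the first coordinates of moved points, which all lie in the open
  square. Points on the line x = t are fixed because they are limits of fixed points from the
  left.\<close>

lemma first_moved_vertical_line:
  assumes f: "f \<in> PL_square_set" and "f \<noteq> id"
  obtains t where "\<And>z. z $ 1 \<le> t \<Longrightarrow> f z = z"
    "\<And>\<delta>. \<delta> > 0 \<Longrightarrow> \<exists>z. 0 < z $ 1 - t \<and> z $ 1 - t < \<delta> \<and> f z \<noteq> z"
proof -
  define X where "X = (\<lambda>z. z $ 1) ` {z. f z \<noteq> z}"
  have ne: "X \<noteq> {}" using \<open>f \<noteq> id\<close> by (auto simp: X_def)
  have bdd: "bdd_below X"
  proof (rule bdd_belowI)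
    fix x assume "x \<in> X"
    then obtain z where z: "x = z $ 1" "f z \<noteq> z" by (auto simp: X_def)
    then have "z \<in> box 0 1" using PL_square_fixes_outside[OF f] by blast
    then show "0 \<le> x" using z(1) by (auto simp: mem_box_cart less_imp_le)
  qed
  have left: "f z = z" if "z $ 1 < Inf X" for z
    using that cInf_lower[OF _ bdd, of "z $ 1"] by (force simp: X_def)
  have left': "f z = z" if z: "z $ 1 \<le> Inf X" for z
  proof -
    have "z \<in> {z. f z = z}"
    proof (rule closed_contains_ray_origin[OF PL_square_closed_fixed[OF f], of 1 _ "- axis 1 1"])
      fix r :: real assume "0 < r"
      then show "z + r *\<^sub>R - axis 1 1 \<in> {z. f z = z}" using z left by simp
    qed simp
    then show ?thesis by simp
  qed
  show thesis
  proof (rule that[of "Inf X"])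
    fix \<delta> :: real assume "\<delta> > 0"
    then obtain x where "x \<in> X" "x < Inf X + \<delta>" using cInf_lessD[OF ne, of "Inf X + \<delta>"] by auto
    then obtain z where z: "f z \<noteq> z" "z $ 1 < Inf X + \<delta>" by (auto simp: X_def)
    moreover have "z $ 1 > Inf X" using left' z(1) by (meson not_le)
    ultimately show "\<exists>z. 0 < z $ 1 - Inf X \<and> z $ 1 - Inf X < \<delta> \<and> f z \<noteq> z" by (intro exI[of _ z]) auto
  qed (rule left')
qed

definition between_lines :: "real \<Rightarrow> real \<Rightarrow> real \<Rightarrow> real \<Rightarrow> real \<Rightarrow> real \<Rightarrow> (real^2) set" where
  "between_lines t \<delta> a b a' b' =
    {z. 0 < z $ 1 - t \<and> z $ 1 - t < \<delta> \<and> 0 < height t a b z \<and> height t a' b' z < 0}"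

text \<open>A region that no bounding line of a cell separates lies in a single cell or outside the
  square, so f is affine on it.  Near x = t this applies to the strips between consecutive
  non-vertical bounding lines, which L records as pairs (a, b).\<close>
lemma PL_square_affine_between_lines:
  assumes f: "f \<in> PL_square_set"
  obtains L \<delta>0 where "finite L" "\<delta>0 > 0"
    "\<forall>a b a' b' \<delta>. 0 < \<delta> \<and> \<delta> \<le> \<delta>0 \<and> (a, b) \<in> L \<and> (a', b') \<in> L \<and> place_less (t, a, b) (t, a', b') \<and>
        (\<forall>k\<in>L. k = (a, b) \<or> place_less (t, k) (t, a, b) \<or> k = (a', b') \<or> place_less (t, a', b') (t, k))
      \<longrightarrow> affine_linear_on (between_lines t \<delta> a b a' b') f"
    "\<forall>a b a' b' z. (a, b) \<in> L \<and> (a', b') \<in> L \<and> place_less (t, a, b) (t, a', b') \<and> 0 < z $ 1 - t \<and> z $ 1 - t < \<delta>0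
      \<longrightarrow> height t a' b' z + \<delta>0 * (z $ 1 - t) \<le> height t a b z"
    "(0, 0) \<in> L" "(1, 0) \<in> L"
proof -
  obtain C where C: "finite C" "\<And>c d. (c, d) \<in> C \<Longrightarrow> c \<noteq> 0"
    "\<And>R. R \<noteq> {} \<Longrightarrow> (\<And>c d. (c, d) \<in> C \<Longrightarrow> (\<forall>z\<in>R. c \<bullet> z \<le> d) \<or> (\<forall>z\<in>R. \<not> c \<bullet> z \<le> d))
      \<Longrightarrow> affine_linear_on R f"
    using PL_square_affine_chambers[OF f] by metis
  \<comment> \<open>Intercept at x = t and slope of a bounding line. For a vertical line both
    divisions by 0 give 0, hence the pair (0, 0), which belongs to \<open>L\<close> anyway.\<close>
  define germ where "germ = (\<lambda>(c :: real^2, d). ((d - c $ 1 * t) / c $ 2, - c $ 1 / c $ 2))"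
  \<comment> \<open>The two added pairs are the lines through the bottom and top edges of the
    square, between which the sweep runs.\<close>
  define L where "L = germ ` C \<union> {(0, 0), (1, 0)}"
  have L: "finite L" using C(1) by (simp add: L_def)
  \<comment> \<open>No vertical bounding line meets the open strip of width \<delta>1 to the right
    of x = t. For c with c1 = 0 the quotient is 0, which can only make the strip narrower.\<close>
  have "\<exists>\<delta>>0. \<forall>(c, d)\<in>C. \<not> (0 < d / c $ 1 - t \<and> d / c $ 1 - t < \<delta>)"
  proof (rule finite_common_bound[OF C(1)])
    fix x assume "x \<in> C"
    show "\<exists>\<delta>>0. case x of (c, d) \<Rightarrow> \<not> (0 < d / c $ 1 - t \<and> d / c $ 1 - t < \<delta>)"
      by (cases x; cases "snd x / fst x $ 1 - t > 0")
        (auto intro: exI[of _ "snd x / fst x $ 1 - t"] exI[of _ 1])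
  qed auto
  then obtain \<delta>1 where d1: "\<delta>1 > 0" "\<And>c d. (c, d) \<in> C \<Longrightarrow> \<not> (0 < d / c $ 1 - t \<and> d / c $ 1 - t < \<delta>1)"
    by blast
  \<comment> \<open>One width for all ordered pairs of lines: within it the lines keep their order
    and separate at least linearly.\<close>
  define gap where "gap = (\<lambda>((a, b), (a', b')) \<delta>. place_less (t, a, b) (t, a', b') \<longrightarrow>
    (\<forall>s. 0 < s \<and> s < \<delta> \<longrightarrow> a + b * s + \<delta> * s \<le> a' + b' * s))"
  have "\<exists>\<delta>>0. \<forall>x\<in>L \<times> L. gap x \<delta>"
  proof (rule finite_common_bound)
    fix x assume "x \<in> L \<times> L"
    obtain a b a' b' where x: "x = ((a, b), (a', b'))" by (cases x) auto
    show "\<exists>\<delta>>0. gap x \<delta>"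
    proof (cases "place_less (t, a, b) (t, a', b')")
      case True
      then show ?thesis using place_less_gap[OF True] unfolding gap_def x prod.case by blast
    next
      case False
      then show ?thesis unfolding gap_def x prod.case using zero_less_one by blast
    qed
  next
    fix x and \<delta> \<epsilon> :: real assume gx: "gap x \<delta>" and e: "0 < \<epsilon>" "\<epsilon> \<le> \<delta>"
    obtain a b a' b' where x: "x = ((a, b), (a', b'))" by (cases x) auto
    show "gap x \<epsilon>"
      unfolding gap_def x prod.case
    proof (intro impI allI)
      fix s assume less: "place_less (t, a, b) (t, a', b')" and s: "0 < s \<and> s < \<epsilon>"
      then have "a + b * s + \<delta> * s \<le> a' + b' * s"
        using gx e unfolding gap_def x prod.case by auto
      moreover have "\<epsilon> * s \<le> \<delta> * s" using s e by (intro mult_right_mono) auto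
      ultimately show "a + b * s + \<epsilon> * s \<le> a' + b' * s" by linarith
    qed
  qed (use L in auto)
  then obtain \<delta>2 where d2: "\<delta>2 > 0" "\<And>x. x \<in> L \<times> L \<Longrightarrow> gap x \<delta>2" by blast
  have gap: "height t a' b' z + \<delta>2 * (z $ 1 - t) \<le> height t a b z"
    if "(a, b) \<in> L" "(a', b') \<in> L" "place_less (t, a, b) (t, a', b')" "0 < z $ 1 - t" "z $ 1 - t < \<delta>2"
    for a b a' b' z
  proof -
    have "gap ((a, b), (a', b')) \<delta>2" using d2(2) that(1,2) by blast
    then have "a + b * (z $ 1 - t) + \<delta>2 * (z $ 1 - t) \<le> a' + b' * (z $ 1 - t)"
      using that(3,4,5) unfolding gap_def prod.case by blast
    then show ?thesis unfolding height_def by linarith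
  qed
  define \<delta>0 where "\<delta>0 = min \<delta>1 \<delta>2"
  have d0: "\<delta>0 > 0" "\<delta>0 \<le> \<delta>1" "\<delta>0 \<le> \<delta>2" using d1 d2 by (auto simp: \<delta>0_def)
  show thesis
  proof (rule that[of L \<delta>0])
    show "(0, 0) \<in> L" "(1, 0) \<in> L" by (auto simp: L_def)
    show "\<forall>a b a' b' z. (a, b) \<in> L \<and> (a', b') \<in> L \<and> place_less (t, a, b) (t, a', b') \<and> 0 < z $ 1 - t \<and> z $ 1 - t < \<delta>0
      \<longrightarrow> height t a' b' z + \<delta>0 * (z $ 1 - t) \<le> height t a b z"
    proof (intro allI impI)
      fix a b a' b' and z :: "real^2"
      assume *: "(a, b) \<in> L \<and> (a', b') \<in> L \<and> place_less (t, a, b) (t, a', b') \<and> 0 < z $ 1 - t \<and> z $ 1 - t < \<delta>0"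
      then have "height t a' b' z + \<delta>2 * (z $ 1 - t) \<le> height t a b z" using gap d0 by auto
      moreover have "\<delta>0 * (z $ 1 - t) \<le> \<delta>2 * (z $ 1 - t)"
        using d0 * by (intro mult_right_mono) auto
      ultimately show "height t a' b' z + \<delta>0 * (z $ 1 - t) \<le> height t a b z" by linarith
    qed
    show "\<forall>a b a' b' \<delta>. 0 < \<delta> \<and> \<delta> \<le> \<delta>0 \<and> (a, b) \<in> L \<and> (a', b') \<in> L \<and> place_less (t, a, b) (t, a', b') \<and>
        (\<forall>k\<in>L. k = (a, b) \<or> place_less (t, k) (t, a, b) \<or> k = (a', b') \<or> place_less (t, a', b') (t, k))
      \<longrightarrow> affine_linear_on (between_lines t \<delta> a b a' b') f"
    proof (intro allI impI, elim conjE)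
      fix a b a' b' \<delta>
      assume d: "0 < \<delta>" "\<delta> \<le> \<delta>0" and less: "place_less (t, a, b) (t, a', b')"
        and cons: "\<forall>k\<in>L. k = (a, b) \<or> place_less (t, k) (t, a, b) \<or> k = (a', b') \<or> place_less (t, a', b') (t, k)"
        and inL: "(a, b) \<in> L" "(a', b') \<in> L"
      define R where "R = between_lines t \<delta> a b a' b'"
      have weak: "height t k' l' z \<le> height t k l z"
        if "(k, l) \<in> L" "(k', l') \<in> L" "(k, l) = (k', l') \<or> place_less (t, k, l) (t, k', l')" "z \<in> R" for k l k' l' z
      proof (cases "place_less (t, k, l) (t, k', l')")
        case True
        have "0 < z $ 1 - t" "z $ 1 - t < \<delta>2" using that(4) d d0 by (auto simp: R_def between_lines_def)
        then show ?thesis using gap[OF that(1,2) True, of z] d2(1) mult_pos_pos[of \<delta>2 "z $ 1 - t"] by linarith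
      qed (use that in auto)
      have "R \<noteq> {}"
      proof -
        define s where "s = \<delta> / 2"
        \<comment> \<open>The witness lies above the lower line by half of the guaranteed
          gap.\<close>
        define z :: "real^2" where "z = vector [t + s, a + b * s + \<delta>2 * s / 2]"
        have z: "z $ 1 = t + s" "z $ 2 = a + b * s + \<delta>2 * s / 2" by (simp_all add: z_def)
        have s: "0 < s" "s < \<delta>" "s < \<delta>2" using d d0 by (auto simp: s_def)
        have ds: "\<delta>2 * s > 0" using s d2(1) by simp
        have h: "height t a b z = \<delta>2 * s / 2" by (simp add: height_def z)
        moreover have "height t a' b' z + \<delta>2 * s \<le> height t a b z"
          using gap[OF inL less, of z] s by (simp add: z)
        ultimately have "0 < height t a b z" "height t a' b' z < 0" using ds by linarith+
        then have "z \<in> R" using s by (simp add: R_def between_lines_def z)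
        then show ?thesis by blast
      qed
      moreover have "(\<forall>z\<in>R. c \<bullet> z \<le> e) \<or> (\<forall>z\<in>R. \<not> c \<bullet> z \<le> e)" if ce: "(c, e) \<in> C" for c e
      proof (cases "c $ 2 = 0")
        case True
        then have c1: "c $ 1 \<noteq> 0" using C(2)[OF ce] by (auto simp: vec_eq_iff forall_2)
        show ?thesis
        proof (rule halfspace_dichotomy[OF c1, of _ "\<lambda>z. z $ 1 - e / c $ 1"])
          show "c \<bullet> z - e = c $ 1 * (z $ 1 - e / c $ 1)" for z
            using True c1 by (simp add: inner_vec_def sum_2 algebra_simps)
          have "e / c $ 1 - t \<le> 0 \<or> e / c $ 1 - t \<ge> \<delta>"
            using d1(2)[OF ce] d d0 by linarith
          then show "(\<forall>z\<in>R. 0 < z $ 1 - e / c $ 1) \<or> (\<forall>z\<in>R. z $ 1 - e / c $ 1 < 0)"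
            by (auto simp: R_def between_lines_def)
        qed
      next
        case False
        obtain k l where kl: "germ (c, e) = (k, l)" by fastforce
        then have "(k, l) \<in> L" using ce by (force simp: L_def)
        show ?thesis
        proof (rule halfspace_dichotomy[OF False, of _ "height t k l"])
          show "c \<bullet> z - e = c $ 2 * height t k l z" for z
            using inner_eq_height[OF False] kl by (auto simp: germ_def)
          \<comment> \<open>No line of \<open>L\<close> lies strictly between the two chosen ones,
            so each is weakly below the lower or weakly above the upper one throughout the
            strip.\<close>
          show "(\<forall>z\<in>R. 0 < height t k l z) \<or> (\<forall>z\<in>R. height t k l z < 0)"
          proof (cases "(k, l) = (a, b) \<or> place_less (t, k, l) (t, a, b)")
            case True
            have "0 < height t k l z" if z: "z \<in> R" for z
              using weak[OF \<open>(k, l) \<in> L\<close> inL(1) True z] z by (auto simp: R_def between_lines_def)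
            then show ?thesis by blast
          next
            case False
            then have le: "(a', b') = (k, l) \<or> place_less (t, a', b') (t, k, l)"
              using bspec[OF cons \<open>(k, l) \<in> L\<close>] by metis
            have "height t k l z < 0" if z: "z \<in> R" for z
              using weak[OF inL(2) \<open>(k, l) \<in> L\<close> le z] z by (auto simp: R_def between_lines_def)
            then show ?thesis by blast
          qed
        qed
      qed
      ultimately show "affine_linear_on (between_lines t \<delta> a b a' b') f"
        using C(3)[of R] unfolding R_def by blast
    qed
  qed (use L d0 in auto)
qed

text \<open>On the first vertical line to whose right f moves points, take the highest ray of
  \<open>L\<close> below which f is the identity near that line, and the next ray of
  \<open>L\<close> above it. Between them f is affine and fixes the lower line by continuity, so it
  is a shear.\<close>

lemma PL_square_nontrivial_germ:
  assumes f: "f \<in> PL_square_set" and "f \<noteq> id"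
  shows "\<exists>P w. has_germ P f w \<and> w \<noteq> 0"
proof -
  obtain t where t: "\<And>z. z $ 1 \<le> t \<Longrightarrow> f z = z"
    "\<And>\<delta>. \<delta> > 0 \<Longrightarrow> \<exists>z. 0 < z $ 1 - t \<and> z $ 1 - t < \<delta> \<and> f z \<noteq> z"
    using first_moved_vertical_line[OF assms] by metis
  obtain L \<delta>0 where L: "finite L" "\<delta>0 > 0" "(0, 0) \<in> L" "(1, 0) \<in> L"
    and affine: "\<forall>a b a' b' \<delta>. 0 < \<delta> \<and> \<delta> \<le> \<delta>0 \<and> (a, b) \<in> L \<and> (a', b') \<in> L \<and> place_less (t, a, b) (t, a', b') \<and>
        (\<forall>k\<in>L. k = (a, b) \<or> place_less (t, k) (t, a, b) \<or> k = (a', b') \<or> place_less (t, a', b') (t, k))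
      \<longrightarrow> affine_linear_on (between_lines t \<delta> a b a' b') f"
    and gap: "\<forall>a b a' b' z. (a, b) \<in> L \<and> (a', b') \<in> L \<and> place_less (t, a, b) (t, a', b') \<and> 0 < z $ 1 - t \<and> z $ 1 - t < \<delta>0
      \<longrightarrow> height t a' b' z + \<delta>0 * (z $ 1 - t) \<le> height t a b z"
    by (rule PL_square_affine_between_lines[OF f, of t])
  define fixed_below where "fixed_below = (\<lambda>(a, b). \<exists>\<delta>>0. \<forall>z.
    0 < z $ 1 - t \<and> z $ 1 - t < \<delta> \<and> height t a b z \<le> 0 \<longrightarrow> f z = z)"
  have outside: "f z = z" if "z $ 2 \<le> 0 \<or> z $ 2 \<ge> 1" for z
  proof -
    have "z \<notin> box 0 1" using that by (auto simp: mem_box_cart not_less intro: exI[of _ 2])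
    then show ?thesis by (rule PL_square_fixes_outside[OF f])
  qed
  have "fixed_below (0, 0)"
    using outside by (auto simp: fixed_below_def height_def intro: exI[of _ 1])
  \<comment> \<open>The bottom edge qualifies, so a largest such ray exists; it is the first ray at
    which f moves something.\<close>
  define B where "B = Pair t ` {q \<in> L. fixed_below q}"
  have "finite B" "B \<noteq> {}" using L \<open>fixed_below (0, 0)\<close> by (auto simp: B_def)
  then obtain m where m: "m \<in> B" "\<And>x. x \<in> B \<Longrightarrow> x = m \<or> place_less x m"
    by (metis place_finite_bound(2))
  obtain a b where ab: "m = (t, a, b)" "(a, b) \<in> L" "fixed_below (a, b)"
    using m(1) by (auto simp: B_def)
  then obtain \<delta>1 where d1: "\<delta>1 > 0"
    "\<And>z. 0 < z $ 1 - t \<Longrightarrow> z $ 1 - t < \<delta>1 \<Longrightarrow> height t a b z \<le> 0 \<Longrightarrow> f z = z"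
    by (auto simp: fixed_below_def)
  define U where "U = {x \<in> Pair t ` L. place_less (t, a, b) x}"
  have "finite U" using L by (simp add: U_def)
  \<comment> \<open>If no ray of \<open>L\<close> were higher, the chosen ray would lie on or above
    the top edge. Then f would be the identity on a whole strip to the right of x = t, against the
    choice of t.\<close>
  have "U \<noteq> {}"
  proof
    assume "U = {}"
    then have "\<not> place_less (t, a, b) (t, 1, 0)" using L(4) unfolding U_def by blast
    then have "a > 1 \<or> a = 1 \<and> b \<ge> 0" by auto
    \<comment> \<open>A horizontal range on which the line stays at or above the level 1; for a = 1
      and b \<ge> 0 any range will do.\<close>
    define K where "K = (if a > 1 then (a - 1) / (\<bar>b\<bar> + 1) else 1)"
    have K: "K > 0" "\<And>s. 0 < s \<Longrightarrow> s < K \<Longrightarrow> a + b * s \<ge> 1"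
    proof -
      show "K > 0" by (simp add: K_def)
      fix s assume s: "0 < s" "s < K"
      show "a + b * s \<ge> 1"
      proof (cases "a > 1")
        case True
        then have "s * (\<bar>b\<bar> + 1) < a - 1" using s by (simp add: K_def pos_less_divide_eq)
        moreover have "- b * s \<le> (\<bar>b\<bar> + 1) * s" using s by (intro mult_right_mono) auto
        ultimately show ?thesis by (simp add: algebra_simps)
      next
        case False
        then show ?thesis using \<open>a > 1 \<or> a = 1 \<and> b \<ge> 0\<close> s by auto
      qed
    qed
    have "f z = z" if "0 < z $ 1 - t" "z $ 1 - t < min \<delta>1 K" for z
    proof (cases "height t a b z \<le> 0")
      case True
      then show ?thesis using d1(2) that by auto
    next
      case False
      then have "z $ 2 \<ge> 1" using K(2)[of "z $ 1 - t"] that by (auto simp: height_def)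
      then show ?thesis by (simp add: outside)
    qed
    then show False using t(2)[of "min \<delta>1 K"] d1(1) K(1) by (metis min_less_iff_conj)
  qed
  then obtain n where n: "n \<in> U" "\<And>x. x \<in> U \<Longrightarrow> x = n \<or> place_less n x"
    using \<open>finite U\<close> by (metis place_finite_bound(1))
  obtain a' b' where ab': "n = (t, a', b')" "(a', b') \<in> L" "place_less (t, a, b) (t, a', b')"
    using n(1) by (auto simp: U_def simp del: place_less.simps)
  define \<delta> where "\<delta> = min \<delta>0 \<delta>1"
  have d: "\<delta> > 0" "\<delta> \<le> \<delta>0" "\<delta> \<le> \<delta>1" using d1 L by (auto simp: \<delta>_def)
  define R where "R = between_lines t \<delta> a b a' b'"
  have "k = (a, b) \<or> place_less (t, k) (t, a, b) \<or> k = (a', b') \<or> place_less (t, a', b') (t, k)" if "k \<in> L" for k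
    using that n(2)[of "(t, k)"] place_less_linear[of "(t, k)" "(t, a, b)"] unfolding ab'(1) U_def by blast
  then have "affine_linear_on R f"
    unfolding R_def using affine d ab(2) ab'(2,3) by blast
  then obtain A e where A: "linear A" and fA: "\<And>z. z \<in> R \<Longrightarrow> f z = A z + e"
    by (auto simp: affine_linear_on_def)
  \<comment> \<open>A point at height h is p + h e2 with p on the fixed lower line, so f moves it by
    h times the displacement that A gives the vertical unit vector e2.\<close>
  define w where "w = A (axis 2 1) - axis 2 1"
  have fw: "f z = z + height t a b z *\<^sub>R w" if z: "z \<in> R" for z
  proof -
    define h where "h = height t a b z"
    define p where "p = z + (- h) *\<^sub>R axis 2 1"
    have h: "h > 0" using z by (simp add: R_def between_lines_def h_def)
    have p1: "p $ 1 = z $ 1" "height t a b p = 0" "height t a' b' p = height t a' b' z - h"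
      unfolding p_def height_axis by (simp_all add: h_def)
    have "p \<in> {x. f x = A x + e}"
    proof (rule closed_contains_ray_origin[OF _ h])
      show "closed {x. f x = A x + e}"
        using A by (intro closed_Collect_eq PL_square_continuous[OF f] continuous_intros linear_continuous_on)
          (simp add: linear_conv_bounded_linear)
      fix r assume "0 < r" "r < h"
      then have "p + r *\<^sub>R axis 2 1 \<in> R"
        using z p1 unfolding R_def between_lines_def mem_Collect_eq height_axis by auto
      then show "p + r *\<^sub>R axis 2 1 \<in> {x. f x = A x + e}" using fA by simp
    qed
    moreover have "f p = p" using d1(2)[of p] p1 z d by (auto simp: R_def between_lines_def)
    ultimately have "A p + e = p" by simp
    have zp: "z = p + h *\<^sub>R axis 2 1" by (simp add: p_def)
    have "f z = A (p + h *\<^sub>R axis 2 1) + e" using fA[OF z] zp by simp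
    also have "\<dots> = (A p + e) + h *\<^sub>R A (axis 2 1)"
      using A by (simp add: linear_add linear_scale)
    also have "\<dots> = z + h *\<^sub>R w"
      unfolding \<open>A p + e = p\<close> w_def using zp by (simp add: algebra_simps)
    finally show ?thesis by (simp add: h_def)
  qed
  \<comment> \<open>If w were 0, f would fix the region between the lines and, by continuity, the
    upper line. The next ray would then qualify too, contradicting maximality.\<close>
  have "w \<noteq> 0"
  proof
    assume "w = 0"
    have "f z = z" if z: "0 < z $ 1 - t" "z $ 1 - t < \<delta>" "height t a' b' z \<le> 0" for z
    proof (cases "height t a b z \<le> 0")
      case True
      then show ?thesis using d1(2) z d by auto
    next
      case False
      define e' where "e' = height t a b z"
      have "z \<in> {z. f z = z}"
      proof (rule closed_contains_ray_origin[OF PL_square_closed_fixed[OF f], of e' _ "- axis 2 1"])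
        show "e' > 0" using False by (simp add: e'_def)
        fix r assume r: "0 < r" "r < e'"
        have "z + (- r) *\<^sub>R axis 2 1 \<in> R"
          unfolding R_def between_lines_def mem_Collect_eq height_axis using z r by (auto simp: e'_def)
        then show "z + r *\<^sub>R - axis 2 1 \<in> {z. f z = z}" using fw \<open>w = 0\<close> by simp
      qed
      then show ?thesis by simp
    qed
    then have "fixed_below (a', b')" using d(1) by (auto simp: fixed_below_def)
    then have "n \<in> B" using ab' by (simp add: B_def)
    then show False
      using m(2)[of n] ab'(3) place_less_irrefl place_less_trans unfolding ab'(1) ab(1) by blast
  qed
  moreover have "has_germ (t, a, b) f w"
  proof -
    have "f z = z + max 0 (height t a b z) *\<^sub>R w" if z: "z \<in> wedge t a b \<delta>" for z
    proof (cases "height t a b z \<le> 0")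
      case True
      then show ?thesis using d1(2)[of z] z d by (auto simp: wedge_def)
    next
      case False
      have s: "0 < z $ 1 - t" "z $ 1 - t < \<delta>" "height t a b z < \<delta> * (z $ 1 - t)"
        using z by (auto simp: wedge_def)
      \<comment> \<open>Heights in the wedge are below \<delta> s, while the next line is at least
        \<delta>0 s higher, so the part of the wedge above the ray lies between the lines.\<close>
      have "height t a' b' z + \<delta>0 * (z $ 1 - t) \<le> height t a b z"
        using gap ab(2) ab'(2,3) s d by (meson less_le_trans)
      moreover have "\<delta> * (z $ 1 - t) \<le> \<delta>0 * (z $ 1 - t)" using s d by (intro mult_right_mono) auto
      ultimately have "height t a' b' z < 0" using s(3) by linarith
      then have "z \<in> R" using s False by (simp add: R_def between_lines_def)
      then show ?thesis using fw False by simp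
    qed
    then show ?thesis using t(1) d(1) by auto
  qed
  ultimately show ?thesis by blast
qed

section \<open>The order and local indicability\<close>

lemma multiplier_scaleR: "multiplier P (c *\<^sub>R w) = 1 + c * (multiplier P w - 1)"
  by (cases P) (simp add: algebra_simps)

lemma multiplier_zero [simp]: "multiplier P 0 = 1"
  by (cases P) simp

text \<open>This is the positive cone of the order. The condition forces w to be nonzero, and by
  \<open>has_germ_mono\<close> and \<open>has_germ_unique\<close> a map has a nonzero germ at one
  ray at most, so the existential speaks of the first ray.\<close>

definition positive_map :: "(real^2 \<Rightarrow> real^2) \<Rightarrow> bool" where
  "positive_map f \<longleftrightarrow> (\<exists>P w. has_germ P f w \<and>
     (multiplier P w > 1 \<or> multiplier P w = 1 \<and> w $ 1 > 0))"

text \<open>If the first rays differ, the later map has trivial germ at the earlier ray, which then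
  decides alone. If they agree, the cone of the affine group is closed under products.\<close>

lemma positive_map_comp:
  assumes "inj g" "positive_map f" "positive_map g"
  shows "positive_map (f \<circ> g)"
proof -
  obtain P v where P: "has_germ P f v" "multiplier P v > 1 \<or> multiplier P v = 1 \<and> v $ 1 > 0"
    using assms(2) unfolding positive_map_def by blast
  obtain Q w where Q: "has_germ Q g w" "multiplier Q w > 1 \<or> multiplier Q w = 1 \<and> w $ 1 > 0"
    using assms(3) unfolding positive_map_def by blast
  consider "place_less P Q" | "P = Q" | "place_less Q P" using place_less_linear by blast
  then show ?thesis
  proof cases
    case 1
    then have "has_germ P (f \<circ> g) v"
      using has_germ_comp[OF P(1) has_germ_mono[OF 1 Q(1)] \<open>inj g\<close>] by simp
    then show ?thesis using P(2) unfolding positive_map_def by blast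
  next
    case 2
    then have "has_germ P (f \<circ> g) (w + multiplier P w *\<^sub>R v)"
      using has_germ_comp[OF P(1) _ \<open>inj g\<close>] Q(1) by simp
    moreover have "multiplier P (w + multiplier P w *\<^sub>R v) > 1 \<or>
        multiplier P (w + multiplier P w *\<^sub>R v) = 1 \<and> (w + multiplier P w *\<^sub>R v) $ 1 > 0"
      unfolding multiplier_comp using P(2) Q(2) 2
      by (auto simp: less_1_mult)
    ultimately show ?thesis unfolding positive_map_def by blast
  next
    case 3
    then have "has_germ Q (f \<circ> g) w"
      using has_germ_comp[OF has_germ_mono[OF 3 P(1)] Q(1) \<open>inj g\<close>] by simp
    then show ?thesis using Q(2) unfolding positive_map_def by blast
  qed
qed

lemma not_positive_map_id: "\<not> positive_map id"
  using has_germ_unique[OF has_germ_id] by (force simp: positive_map_def)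

lemma positive_map_or_inverse:
  assumes f: "f \<in> PL_square_set" and "f \<noteq> id"
  shows "positive_map f \<or> positive_map (inv_into UNIV f)"
proof -
  obtain P w where w: "has_germ P f w" "w \<noteq> 0"
    using PL_square_nontrivial_germ[OF assms] by blast
  have bij: "bij f" by (rule PL_square_bij[OF f])
  have inv: "has_germ P (inv_into UNIV f) (- (1 / multiplier P w) *\<^sub>R w)"
    by (rule has_germ_inv[OF w(1) bij])
  have pos: "multiplier P w > 0" by (rule multiplier_pos[OF w(1) bij_is_inj[OF bij]])
  have eq: "multiplier P (- (1 / multiplier P w) *\<^sub>R w) = 1 / multiplier P w"
    unfolding multiplier_scaleR using pos by (simp add: right_diff_distrib)
  \<comment> \<open>With multiplier 1, the first coordinate of w determines the second as b times
    it, so it cannot vanish unless w does.\<close>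
  have "w $ 1 \<noteq> 0" if "multiplier P w = 1"
  proof
    assume "w $ 1 = 0"
    then have "w = 0" using that by (cases P) (auto simp: vec_eq_iff forall_2)
    then show False using w by simp
  qed
  then consider "multiplier P w > 1 \<or> multiplier P w = 1 \<and> w $ 1 > 0"
    | "multiplier P w < 1 \<or> multiplier P w = 1 \<and> w $ 1 < 0"
    by linarith
  then show ?thesis
  proof cases
    case 1
    then show ?thesis using w(1) unfolding positive_map_def by blast
  next
    case 2
    then have "multiplier P (- (1 / multiplier P w) *\<^sub>R w) > 1 \<or>
      multiplier P (- (1 / multiplier P w) *\<^sub>R w) = 1 \<and> (- (1 / multiplier P w) *\<^sub>R w) $ 1 > 0"
      unfolding eq using pos by auto
    then show ?thesis using inv unfolding positive_map_def by blast
  qed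
qed

lemma left_orderable_PL_square: "left_orderable PL_square"
proof -
  \<comment> \<open>The usual order of a positive cone: left invariance holds because a common left
    factor cancels in the quotient, and totality is the trichotomy for that quotient.\<close>
  define r where "r = {(f, g). f \<in> PL_square_set \<and> g \<in> PL_square_set \<and> positive_map (inv_into UNIV f \<circ> g)}"
  have surj: "f (inv_into UNIV f z) = z" if "f \<in> PL_square_set" for f z
    using PL_square_bij[OF that] by (simp add: bij_is_surj surj_f_inv_f)
  have inj: "inv_into UNIV f (f z) = z" if "f \<in> PL_square_set" for f z
    using PL_square_bij[OF that] by (simp add: bij_is_inj)
  have "trans r"
  proof (rule transI)
    fix f g h assume "(f, g) \<in> r" "(g, h) \<in> r"
    then have *: "f \<in> PL_square_set" "g \<in> PL_square_set" "h \<in> PL_square_set"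
      "positive_map (inv_into UNIV f \<circ> g)" "positive_map (inv_into UNIV g \<circ> h)" by (auto simp: r_def)
    have "inj (inv_into UNIV g \<circ> h)"
      using * by (intro bij_is_inj PL_square_bij PL_square_compose PL_square_inverse)
    then have "positive_map ((inv_into UNIV f \<circ> g) \<circ> (inv_into UNIV g \<circ> h))"
      by (rule positive_map_comp) (use * in auto)
    moreover have "(inv_into UNIV f \<circ> g) \<circ> (inv_into UNIV g \<circ> h) = inv_into UNIV f \<circ> h"
      using surj[OF *(2)] by (simp add: fun_eq_iff)
    ultimately show "(f, h) \<in> r" using * by (simp add: r_def)
  qed
  moreover have "irrefl r"
  proof (rule irreflI)
    fix f show "(f, f) \<notin> r"
    proof
      assume "(f, f) \<in> r"
      then have "f \<in> PL_square_set" "positive_map (inv_into UNIV f \<circ> f)" by (auto simp: r_def)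
      moreover from this have "inv_into UNIV f \<circ> f = id" using inj by (simp add: fun_eq_iff)
      ultimately show False using not_positive_map_id by simp
    qed
  qed
  moreover have "total_on PL_square_set r"
  proof (rule total_onI)
    fix f g assume f: "f \<in> PL_square_set" and g: "g \<in> PL_square_set" and "f \<noteq> g"
    define h where "h = inv_into UNIV f \<circ> g"
    have h: "h \<in> PL_square_set" unfolding h_def by (intro PL_square_compose PL_square_inverse f g)
    have "f \<circ> h = g" using surj[OF f] by (simp add: h_def fun_eq_iff)
    then have "h \<noteq> id" using \<open>f \<noteq> g\<close> by auto
    moreover have "inv_into UNIV h = inv_into UNIV g \<circ> f"
    proof
      fix z
      have "h ((inv_into UNIV g \<circ> f) z) = z" using surj[OF g] inj[OF f] by (simp add: h_def)
      then show "inv_into UNIV h z = (inv_into UNIV g \<circ> f) z" using inj[OF h] by metis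
    qed
    ultimately show "(f, g) \<in> r \<or> (g, f) \<in> r"
      using positive_map_or_inverse[OF h] f g by (auto simp: r_def h_def)
  qed
  moreover have "(h \<circ> f, h \<circ> g) \<in> r" if h: "h \<in> PL_square_set" and fg: "(f, g) \<in> r" for h f g
  proof -
    have f: "f \<in> PL_square_set" and g: "g \<in> PL_square_set" using fg by (auto simp: r_def)
    have hf: "h \<circ> f \<in> PL_square_set" by (rule PL_square_compose[OF h f])
    have "inv_into UNIV (h \<circ> f) ((h \<circ> g) z) = (inv_into UNIV f \<circ> g) z" for z
    proof -
      have "(h \<circ> f) ((inv_into UNIV f \<circ> g) z) = (h \<circ> g) z" using surj[OF f] by simp
      then show ?thesis using inj[OF hf] by metis
    qed
    then have "inv_into UNIV (h \<circ> f) \<circ> (h \<circ> g) = inv_into UNIV f \<circ> g" by (simp add: fun_eq_iff)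
    then show ?thesis using fg hf PL_square_compose[OF h g] by (simp add: r_def)
  qed
  moreover have "r \<subseteq> PL_square_set \<times> PL_square_set" by (auto simp: r_def)
  ultimately show ?thesis
    unfolding left_orderable_def strict_linear_order_on_def PL_square_simps by (intro exI[of _ r]) simp
qed

text \<open>Choose the least first ray among the nontrivial generators; every generator whose first
  ray is later has trivial germ there.\<close>

lemma generated_common_germ:
  assumes S: "finite S" "S \<subseteq> PL_square_set" and ne: "\<exists>s\<in>S. s \<noteq> id"
  shows "\<exists>P. (\<forall>s\<in>S. \<exists>w. has_germ P s w) \<and> (\<exists>s\<in>S. \<exists>w. has_germ P s w \<and> w \<noteq> 0)"
proof -
  have "\<forall>s\<in>S - {id}. \<exists>P. \<exists>w. has_germ P s w \<and> w \<noteq> 0"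
    using PL_square_nontrivial_germ S(2) by blast
  from bchoice[OF this] obtain p where p: "\<And>s. s \<in> S - {id} \<Longrightarrow> \<exists>w. has_germ (p s) s w \<and> w \<noteq> 0"
    by blast
  have "finite (p ` (S - {id}))" "p ` (S - {id}) \<noteq> {}" using S(1) ne by auto
  then obtain P where P: "P \<in> p ` (S - {id})" "\<And>Q. Q \<in> p ` (S - {id}) \<Longrightarrow> Q = P \<or> place_less P Q"
    by (metis place_finite_bound(1))
  have "\<exists>w. has_germ P s w" if "s \<in> S" for s
  proof (cases "s = id")
    case True
    then show ?thesis using has_germ_id by blast
  next
    case False
    then obtain w where "has_germ (p s) s w" using p \<open>s \<in> S\<close> by blast
    moreover have "p s = P \<or> place_less P (p s)" using P(2) \<open>s \<in> S\<close> False by blast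
    ultimately show ?thesis using has_germ_mono by metis
  qed
  then show ?thesis using P(1) p by blast
qed

lemma locally_indicable_PL_square: "locally_indicable PL_square"
  unfolding locally_indicable_def
proof (intro allI impI, elim exE conjE)
  fix H S
  assume H: "subgroup H PL_square" and ne: "H \<noteq> {\<one>\<^bsub>PL_square\<^esub>}"
    and S: "finite S" "S \<subseteq> carrier PL_square" and gen: "generate PL_square S = H"
  interpret group PL_square by (rule group_PL_square)
  have SP: "S \<subseteq> PL_square_set" using S by simp
  have HP: "H \<subseteq> PL_square_set" using subgroup.subset[OF H] by simp
  have "\<exists>s\<in>S. s \<noteq> id"
  proof (rule ccontr)
    assume "\<not> (\<exists>s\<in>S. s \<noteq> id)"
    then have "S \<subseteq> {\<one>\<^bsub>PL_square\<^esub>}" by auto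
    then have "generate PL_square S \<subseteq> {\<one>\<^bsub>PL_square\<^esub>}"
      using mono_generate generate_one by blast
    then show False using ne gen generate.one[of PL_square S] by blast
  qed
  then obtain P where P: "\<And>s. s \<in> S \<Longrightarrow> \<exists>w. has_germ P s w" "\<exists>s\<in>S. \<exists>w. has_germ P s w \<and> w \<noteq> 0"
    using generated_common_germ[OF S(1) SP] by blast
  \<comment> \<open>Germs at P pass from the generators to the whole group, since they are stable
    under products and inverses.\<close>
  have germ_ex: "\<exists>w. has_germ P h w" if "h \<in> generate PL_square S" for h
    using that
  proof induction
    case one
    show ?case unfolding PL_square_simps by (rule exI, rule has_germ_id)
  next
    case (incl h)
    then show ?case by (rule P(1))
  next
    case (inv h)
    then have h: "h \<in> PL_square_set" using SP by blast
    obtain w where "has_germ P h w" using P(1)[OF inv] by (rule exE)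
    from has_germ_inv[OF this PL_square_bij[OF h]]
    show ?case unfolding PL_square_inv[OF h] by (rule exI)
  next
    case (eng h k)
    then have "k \<in> PL_square_set" using gen HP by blast
    then have k: "inj k" by (intro bij_is_inj PL_square_bij)
    obtain v w where "has_germ P h v" "has_germ P k w" using eng.IH by (elim exE)
    from has_germ_comp[OF this k] show ?case unfolding PL_square_simps by (rule exI)
  qed
  define W where "W h = (THE w. has_germ P h w)" for h
  have W: "W h = w" if "has_germ P h w" for h w
    unfolding W_def using that has_germ_unique by blast
  have germ: "has_germ P h (W h)" if "h \<in> H" for h
    using germ_ex[of h] that gen W by blast
  have inj: "inj h" if "h \<in> H" for h
    using HP that by (intro bij_is_inj PL_square_bij) blast
  have W_comp: "W (f \<circ> g) = W g + multiplier P (W g) *\<^sub>R W f" if "f \<in> H" "g \<in> H" for f g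
    using has_germ_comp[OF germ germ inj] that by (intro W) blast
  have mult_pos: "multiplier P (W h) > 0" if "h \<in> H" for h
    using multiplier_pos[OF germ inj] that by blast
  obtain s where s: "s \<in> H" "W s \<noteq> 0"
    using P(2) W gen generate.incl[of _ S PL_square] by metis
  show "\<exists>\<phi>. \<phi> \<in> hom (PL_square\<lparr>carrier := H\<rparr>) integer_group \<and> \<phi> ` H = carrier integer_group"
  proof (cases "\<exists>h\<in>H. multiplier P (W h) \<noteq> 1")
    case True
    then obtain h where h: "h \<in> H" "multiplier P (W h) \<noteq> 1" by blast
    show ?thesis
    proof (rule finitely_generated_hom_onto_int[OF H S(1) gen _ h(1)])
      show "ln (multiplier P (W (x \<otimes>\<^bsub>PL_square\<^esub> y))) = ln (multiplier P (W x)) + ln (multiplier P (W y))"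
        if "x \<in> H" "y \<in> H" for x y
        using that mult_pos by (simp add: W_comp multiplier_comp ln_mult_pos)
      show "ln (multiplier P (W h)) \<noteq> 0" using h mult_pos[OF h(1)] by simp
    qed
  next
    case False
    \<comment> \<open>All multipliers are now 1, so the group law on germs is plain addition of
      vectors and each coordinate is a homomorphism to the reals.\<close>
    obtain i where i: "W s $ i \<noteq> 0" using s(2) by (auto simp: vec_eq_iff)
    show ?thesis
    proof (rule finitely_generated_hom_onto_int[OF H S(1) gen _ s(1)])
      show "W (x \<otimes>\<^bsub>PL_square\<^esub> y) $ i = W x $ i + W y $ i" if "x \<in> H" "y \<in> H" for x y
        using that False by (simp add: W_comp)
      show "W s $ i \<noteq> 0" by (rule i)
    qed
  qed
qed

theorem mainTheorem18:
  shows "locally_indicable PL_square \<and> left_orderable PL_square"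
  by (intro conjI locally_indicable_PL_square left_orderable_PL_square)

end
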